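(* Let $x$ be the solution of the mean square asymptotically stable equation $$dx(t)=[Ax(t)+Bu(t)]\,dt+\sum_{i=1}^q[N_ix(t)+M_iu(t)]\,dw_i(t),\quad x(0)=x_0=0,\quad t\in[0,T],$$ with $u\in L^2_T$. Let $\gamma>0$ and let $P>0$ be a symmetric matrix satisfying $U(P^{-1})>0$ and $$L(P^{-1})+S(P^{-1})U(P^{-1})^{-1}S(P^{-1})^\top\le0 .$$ Let $(p_k)_{k=1,\dots,n}$ be an orthonormal basis of $\mathbb R^n$ of eigenvectors of $P$ with associated eigenvalues $\lambda_k>0$, so that $x(t)=\sum_{k=1}^n\langle x(t),p_k\rangle_2\,p_k$. Then, for each $k$, $$\sup_{t\in[0,T]}\mathbb E\,\langle x(t),p_k\rangle_2^2\le\lambda_k\,\gamma\,\|u\|_{L^2_T}^2 .$$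
   Context: Setting: $(\Omega,\mathcal F,(\mathcal F_t),\mathbb P)$ is a filtered probability space with right-continuous and complete filtration; $w=(w_1,\dots,w_q)^\top$ is an $\mathbb R^q$-valued $(\mathcal F_t)$-adapted Wiener process whose increments $w(t+h)-w(t)$ are independent of $\mathcal F_t$, with covariance matrix $K=(k_{ij})_{i,j=1,\dots,q}$, i.e. $\mathbb E[w(t)w(t)^\top]=Kt$. The coefficients are $A,N_i\in\mathbb R^{n\times n}$, $B,M_i\in\mathbb R^{n\times m}$. $u\in L^2_T$ means that $u$ is an $\mathbb R^m$-valued $(\mathcal F_t)$-adapted control with $\|u\|_{L^2_T}^2=\mathbb E\int_0^T\|u(t)\|_2^2dt<\infty$. $\langle\cdot,\cdot\rangle_2$, $\|\cdot\|_2$ are the Euclidean inner product and norm. Mean square asymptotic stability means: for $u\equiv0$ and any initial state $x_0\in\mathbb R^n$, $\mathbb E\|x(t)\|_2^2\to0$ as $t\to\infty$. For symmetric matrices, $M_1\ge M_2$ ($M_1>M_2$) means $M_1-M_2$ is positive semidefinite (definite). Operators: $L(X)=A^\top X+XA+\sum_{i,j=1}^qN_i^\top XN_jk_{ij}$, $S(X)=XB+\sum_{i,j=1}^qN_i^\top XM_jk_{ij}$, $U(X)=\gamma I-\sum_{i,j=1}^qM_i^\top XM_jk_{ij}$. *)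

theory Defs
  imports "HOL-Probability.Probability"
begin

section \<open>Filtered probability space and Wiener process\<close>

text \<open>
  The time axis is \<open>[0,\<infinity>)\<close>; processes and filtrations are functions on \<open>real\<close> whose values at
  negative times are never used.
\<close>

definition usual_filtration :: "'a measure \<Rightarrow> (real \<Rightarrow> 'a measure) \<Rightarrow> bool" where
  "usual_filtration M F \<longleftrightarrow>
     (\<forall>t\<ge>0. subalgebra M (F t)) \<and>
     (\<forall>s t. 0 \<le> s \<and> s \<le> t \<longrightarrow> sets (F s) \<subseteq> sets (F t)) \<and>
     (\<forall>t\<ge>0. sets (F t) = (\<Inter>s\<in>{t<..}. sets (F s))) \<and>
     (\<forall>Z\<in>null_sets M. \<forall>A. A \<subseteq> Z \<longrightarrow> A \<in> sets (F 0))"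

text \<open>
  A centred Gaussian vector: every linear functional of it is a centred Gaussian variable. Point
  masses are included (\<open>\<sigma> = 0\<close>), so that singular covariance matrices are allowed.
\<close>

definition centred_gaussian :: "'a measure \<Rightarrow> ('a \<Rightarrow> real ^ 'q) \<Rightarrow> bool" where
  "centred_gaussian M X \<longleftrightarrow>
     X \<in> borel_measurable M \<and>
     (\<forall>v. \<exists>\<sigma>\<ge>0. distr M borel (\<lambda>\<omega>. v \<bullet> X \<omega>) =
        (if \<sigma> = 0 then return borel 0 else density lborel (normal_density 0 \<sigma>)))"

text \<open>
  The covariance clause with \<open>s = 0\<close> is \<open>E[w(t) w(t)\<^sup>T] = t K\<close>, read entrywise.
\<close>

definition wiener_process ::
  "'a measure \<Rightarrow> (real \<Rightarrow> 'a measure) \<Rightarrow> real ^ 'q ^ 'q \<Rightarrow> (real \<Rightarrow> 'a \<Rightarrow> real ^ 'q) \<Rightarrow> bool" where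
  "wiener_process M F K w \<longleftrightarrow>
     (\<forall>t\<ge>0. w t \<in> borel_measurable (F t)) \<and>
     (AE \<omega> in M. w 0 \<omega> = 0) \<and>
     (AE \<omega> in M. continuous_on {0..} (\<lambda>t. w t \<omega>)) \<and>
     (\<forall>s t. 0 \<le> s \<and> s \<le> t \<longrightarrow>
        prob_space.indep_set M (sets (F s))
          {(\<lambda>\<omega>. w t \<omega> - w s \<omega>) -` C \<inter> space M | C. C \<in> sets borel} \<and>
        centred_gaussian M (\<lambda>\<omega>. w t \<omega> - w s \<omega>) \<and>
        (\<forall>i j. prob_space.expectation M (\<lambda>\<omega>. (w t \<omega> - w s \<omega>) $ i * (w t \<omega> - w s \<omega>) $ j)
                 = (t - s) * K $ i $ j))"

section \<open>Square integrable adapted processes\<close>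

definition L2T_norm_sq :: "'a measure \<Rightarrow> real \<Rightarrow> (real \<Rightarrow> 'a \<Rightarrow> 'b::euclidean_space) \<Rightarrow> ennreal" where
  "L2T_norm_sq M T v = (\<integral>\<^sup>+\<omega>. (\<integral>\<^sup>+t\<in>{0..T}. ennreal ((norm (v t \<omega>))\<^sup>2) \<partial>lborel) \<partial>M)"

text \<open>
  Besides adaptedness we require joint measurability in time and chance, without which the
  iterated integral in the norm has no meaning.
\<close>

definition L2T ::
  "'a measure \<Rightarrow> (real \<Rightarrow> 'a measure) \<Rightarrow> real \<Rightarrow> (real \<Rightarrow> 'a \<Rightarrow> 'b::euclidean_space) set" where
  "L2T M F T = {v.
     (\<forall>t\<in>{0..T}. v t \<in> borel_measurable (F t)) \<and>
     (\<lambda>(t, \<omega>). v t \<omega>) \<in> borel_measurable (restrict_space borel {0..T} \<Otimes>\<^sub>M M) \<and>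
     L2T_norm_sq M T v < \<infinity>}"

section \<open>It\^o integral\<close>

text \<open>
  A simple process \<open>\<Sum>k<m. 1\<^bsub>(\<tau> k, \<tau> (k+1)]\<^esub> \<xi> k\<close> is represented by the triple \<open>(m, \<tau>, \<xi>)\<close>.
\<close>

definition simple_process ::
  "'a measure \<Rightarrow> (real \<Rightarrow> 'a measure) \<Rightarrow> nat \<Rightarrow> (nat \<Rightarrow> real) \<Rightarrow>
   (nat \<Rightarrow> 'a \<Rightarrow> 'b::euclidean_space) \<Rightarrow> bool" where
  "simple_process M F m \<tau> \<xi> \<longleftrightarrow>
     0 \<le> \<tau> 0 \<and> (\<forall>k<m. \<tau> k < \<tau> (Suc k)) \<and>
     (\<forall>k<m. \<xi> k \<in> borel_measurable (F (\<tau> k)) \<and> (\<exists>c. \<forall>\<omega>\<in>space M. norm (\<xi> k \<omega>) \<le> c))"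

definition simple_value ::
  "nat \<Rightarrow> (nat \<Rightarrow> real) \<Rightarrow> (nat \<Rightarrow> 'a \<Rightarrow> 'b::euclidean_space) \<Rightarrow> real \<Rightarrow> 'a \<Rightarrow> 'b" where
  "simple_value m \<tau> \<xi> s \<omega> = (\<Sum>k<m. indicat_real {\<tau> k<..\<tau> (Suc k)} s *\<^sub>R \<xi> k \<omega>)"

definition simple_integral_upto ::
  "(real \<Rightarrow> 'a \<Rightarrow> real) \<Rightarrow> nat \<Rightarrow> (nat \<Rightarrow> real) \<Rightarrow> (nat \<Rightarrow> 'a \<Rightarrow> 'b::euclidean_space) \<Rightarrow>
   real \<Rightarrow> 'a \<Rightarrow> 'b" where
  "simple_integral_upto \<beta> m \<tau> \<xi> t \<omega> =
     (\<Sum>k<m. (\<beta> (min t (\<tau> (Suc k))) \<omega> - \<beta> (min t (\<tau> k)) \<omega>) *\<^sub>R \<xi> k \<omega>)"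

text \<open>
  \<open>Y\<close> is a version of \<open>\<integral>\<^sub>0\<^sup>t f d\<beta>\<close>: the mean square limit of the integrals of simple processes that
  approximate the integrand in the norm of \<open>L\<^sup>2(\<Omega> \<times> [0,t])\<close>. By the It\^o isometry \<open>Y\<close> is determined
  almost surely and does not depend on the approximating sequence.
\<close>

definition has_ito_integral ::
  "'a measure \<Rightarrow> (real \<Rightarrow> 'a measure) \<Rightarrow> (real \<Rightarrow> 'a \<Rightarrow> real) \<Rightarrow>
   (real \<Rightarrow> 'a \<Rightarrow> 'b::euclidean_space) \<Rightarrow> real \<Rightarrow> ('a \<Rightarrow> 'b) \<Rightarrow> bool" where
  "has_ito_integral M F \<beta> f t Y \<longleftrightarrow>
     f \<in> L2T M F t \<and> Y \<in> borel_measurable M \<and>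
     (\<exists>m \<tau> \<xi>. (\<forall>j::nat. simple_process M F (m j) (\<tau> j) (\<xi> j)) \<and>
        (\<lambda>j. L2T_norm_sq M t (\<lambda>s \<omega>. f s \<omega> - simple_value (m j) (\<tau> j) (\<xi> j) s \<omega>))
          \<longlonglongrightarrow> 0 \<and>
        (\<lambda>j. \<integral>\<^sup>+\<omega>. ennreal ((norm (Y \<omega> - simple_integral_upto \<beta> (m j) (\<tau> j) (\<xi> j) t \<omega>))\<^sup>2) \<partial>M)
          \<longlonglongrightarrow> 0)"

section \<open>The controlled equation\<close>

definition sde_solution ::
  "'a measure \<Rightarrow> (real \<Rightarrow> 'a measure) \<Rightarrow> (real \<Rightarrow> 'a \<Rightarrow> real ^ 'q) \<Rightarrow>
   real ^ 'n ^ 'n \<Rightarrow> real ^ 'm ^ 'n \<Rightarrow> ('q \<Rightarrow> real ^ 'n ^ 'n) \<Rightarrow> ('q \<Rightarrow> real ^ 'm ^ 'n) \<Rightarrow>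
   (real \<Rightarrow> 'a \<Rightarrow> real ^ 'm) \<Rightarrow> real ^ 'n \<Rightarrow> real \<Rightarrow> (real \<Rightarrow> 'a \<Rightarrow> real ^ 'n) \<Rightarrow> bool" where
  "sde_solution M F w A B N Mc u x0 T x \<longleftrightarrow>
     x \<in> L2T M F T \<and>
     (AE \<omega> in M. continuous_on {0..T} (\<lambda>t. x t \<omega>)) \<and>
     (\<forall>t\<in>{0..T}. \<exists>Y :: 'q \<Rightarrow> 'a \<Rightarrow> real ^ 'n.
        (\<forall>i. has_ito_integral M F (\<lambda>s \<omega>. w s \<omega> $ i)
               (\<lambda>s \<omega>. N i *v x s \<omega> + Mc i *v u s \<omega>) t (Y i)) \<and>
        (AE \<omega> in M. x t \<omega> =
           x0 + (LBINT s:{0..t}. A *v x s \<omega> + B *v u s \<omega>) + (\<Sum>i\<in>UNIV. Y i \<omega>)))"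

definition mean_square_asymptotically_stable ::
  "'a measure \<Rightarrow> (real \<Rightarrow> 'a measure) \<Rightarrow> (real \<Rightarrow> 'a \<Rightarrow> real ^ 'q) \<Rightarrow>
   real ^ 'n ^ 'n \<Rightarrow> real ^ 'm ^ 'n \<Rightarrow> ('q \<Rightarrow> real ^ 'n ^ 'n) \<Rightarrow> ('q \<Rightarrow> real ^ 'm ^ 'n) \<Rightarrow> bool" where
  "mean_square_asymptotically_stable M F w A B N Mc \<longleftrightarrow>
     (\<forall>x0 x. (\<forall>T>0. sde_solution M F w A B N Mc (\<lambda>t \<omega>. 0) x0 T x) \<longrightarrow>
        ((\<lambda>t. \<integral>\<^sup>+\<omega>. ennreal ((norm (x t \<omega>))\<^sup>2) \<partial>M) \<longlongrightarrow> 0) at_top)"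

section \<open>Matrices\<close>

definition pos_semidefinite :: "real ^ 'n ^ 'n \<Rightarrow> bool" where
  "pos_semidefinite X \<longleftrightarrow> transpose X = X \<and> (\<forall>v. 0 \<le> v \<bullet> (X *v v))"

definition pos_definite :: "real ^ 'n ^ 'n \<Rightarrow> bool" where
  "pos_definite X \<longleftrightarrow> transpose X = X \<and> (\<forall>v. v \<noteq> 0 \<longrightarrow> 0 < v \<bullet> (X *v v))"

definition loewner_le :: "real ^ 'n ^ 'n \<Rightarrow> real ^ 'n ^ 'n \<Rightarrow> bool" where
  "loewner_le X Y \<longleftrightarrow> pos_semidefinite (Y - X)"

definition op_L ::
  "real ^ 'n ^ 'n \<Rightarrow> ('q::finite \<Rightarrow> real ^ 'n ^ 'n) \<Rightarrow> real ^ 'q ^ 'q \<Rightarrow>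
   real ^ 'n ^ 'n \<Rightarrow> real ^ 'n ^ 'n" where
  "op_L A N K X = transpose A ** X + X ** A +
     (\<Sum>i\<in>UNIV. \<Sum>j\<in>UNIV. K $ i $ j *\<^sub>R (transpose (N i) ** X ** N j))"

definition op_S ::
  "real ^ 'm ^ 'n \<Rightarrow> ('q::finite \<Rightarrow> real ^ 'n ^ 'n) \<Rightarrow> ('q \<Rightarrow> real ^ 'm ^ 'n) \<Rightarrow> real ^ 'q ^ 'q \<Rightarrow>
   real ^ 'n ^ 'n \<Rightarrow> real ^ 'm ^ 'n" where
  "op_S B N Mc K X = X ** B +
     (\<Sum>i\<in>UNIV. \<Sum>j\<in>UNIV. K $ i $ j *\<^sub>R (transpose (N i) ** X ** Mc j))"

definition op_U ::
  "real \<Rightarrow> ('q::finite \<Rightarrow> real ^ 'm ^ 'n) \<Rightarrow> real ^ 'q ^ 'q \<Rightarrow>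
   real ^ 'n ^ 'n \<Rightarrow> real ^ 'm ^ 'm" where
  "op_U \<gamma> Mc K X = \<gamma> *\<^sub>R mat 1 -
     (\<Sum>i\<in>UNIV. \<Sum>j\<in>UNIV. K $ i $ j *\<^sub>R (transpose (Mc i) ** X ** Mc j))"

text \<open>The index type \<open>'n\<close> is that of the coordinates, so a family has exactly \<open>n\<close> members.\<close>

definition orthonormal_basis :: "('n \<Rightarrow> real ^ 'n) \<Rightarrow> bool" where
  "orthonormal_basis p \<longleftrightarrow>
     (\<forall>k l. p k \<bullet> p l = (if k = l then 1 else 0)) \<and> span (range p) = UNIV"

end

theory Submission
  imports Defs
begin

text \<open>
  Put \<open>X = P\<^sup>-\<^sup>1\<close> and measure the state by the energy \<open>\<langle>x, X x\<rangle>\<close>. An eigenvector \<open>p\<close> of \<open>P\<close> with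
  \<open>P p = \<lambda> p\<close> and \<open>|p| = 1\<close> satisfies \<open>\<langle>x, p\<rangle>\<^sup>2 \<le> \<lambda> \<langle>x, X x\<rangle>\<close> (\<open>eigenvector_component_bound\<close>), so it is
  enough that the mean energy at time \<open>t\<close> is at most \<open>\<gamma>\<close> times the squared norm of the control. With the
  drift \<open>b = A x + B u\<close> and the noise coefficients \<open>f\<^sub>i = N\<^sub>i x + M\<^sub>i u\<close>, the mean energy grows at the rate
  \<open>E [2 \<langle>b, X x\<rangle> + \<Sum>\<^sub>i\<^sub>j k\<^sub>i\<^sub>j \<langle>f\<^sub>i, X f\<^sub>j\<rangle>]\<close> (\<open>energy_identity\<close>). As a quadratic form in \<open>(x, u)\<close> the
  bracket is \<open>\<langle>x, L(X) x\<rangle> + 2 \<langle>x, S(X) u\<rangle> - \<langle>u, U(X) u\<rangle> + \<gamma> |u|\<^sup>2\<close>; completing the square in \<open>u\<close> and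
  using the Riccati inequality, it is at most \<open>\<gamma> |u|\<^sup>2\<close> (\<open>energy_rate_bound\<close>).

  The energy identity is the expectation of Ito's formula for a quadratic form, and it follows from the
  linear theory of the stochastic integral. Write \<open>x(t) = V(t) + J(t)\<close> with the integrated drift
  \<open>V(t) = \<integral>\<^sub>0\<^sup>t b\<close> and the sum \<open>J(t)\<close> of the stochastic integrals, and expand the square.

  \<^item> The term \<open>E \<langle>J, X J\<rangle>\<close> is given by the Ito isometry for a pair of correlated Brownian motions
    (\<open>ito_isometry\<close>).

  \<^item> For the term \<open>E \<langle>V, X V\<rangle>\<close>, the identity \<open>\<langle>V, X V\<rangle> = 2 \<integral>\<^sub>0\<^sup>t \<langle>b, X V\<rangle>\<close> holds path by path, by symmetry of \<open>X\<close>
    and Fubini's theorem on the square \<open>[0,t]\<^sup>2\<close> (\<open>square_of_integral\<close>).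

  \<^item> In the mixed term \<open>2 E \<langle>V(t), X J(t)\<rangle> = 2 \<integral>\<^sub>0\<^sup>t E \<langle>b(s), X J(t)\<rangle> ds\<close> the vector \<open>b(s)\<close> is known at time
    \<open>s\<close>, so the martingale property (\<open>ito_martingale\<close>) replaces \<open>J(t)\<close> by \<open>J(s) = x(s) - V(s)\<close>.

  In the sum the contributions of \<open>V\<close> cancel and \<open>2 E \<integral>\<^sub>0\<^sup>t \<langle>b, X x\<rangle>\<close> remains.

  Isometry and martingale property are verified for simple integrands, where they reduce to the moments of
  the increments of the Wiener process, and pass to the limit because the \<open>L\<^sup>2\<close> inner product is continuous
  (\<open>L2lim_inner\<close>). An integrand on \<open>[0,t]\<close> is treated throughout as one function on the product of
  Lebesgue measure and the probability measure that vanishes outside \<open>[0,t]\<close> (\<open>cut\<close>).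
\<close>

section \<open>Square integrable functions and mean square limits\<close>

definition sqint :: "'a measure \<Rightarrow> ('a \<Rightarrow> 'b::euclidean_space) \<Rightarrow> bool" where
  "sqint \<mu> f \<longleftrightarrow> f \<in> borel_measurable \<mu> \<and> integrable \<mu> (\<lambda>z. (norm (f z))\<^sup>2)"

lemma sqint_measurable: "sqint \<mu> f \<Longrightarrow> f \<in> borel_measurable \<mu>"
  by (simp add: sqint_def)

lemma sqintI_bound:
  assumes "f \<in> borel_measurable \<mu>" "integrable \<mu> g" "\<And>z. z \<in> space \<mu> \<Longrightarrow> (norm (f z))\<^sup>2 \<le> g z"
  shows "sqint \<mu> f"
  unfolding sqint_def
proof (intro conjI)
  show "integrable \<mu> (\<lambda>z. (norm (f z))\<^sup>2)"
    by (rule Bochner_Integration.integrable_bound[OF assms(2)])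
       (use assms in \<open>auto intro!: AE_I2 order_trans[OF assms(3)]\<close>)
qed (fact assms(1))

lemma norm_add_sq_le: "(norm (a + b))\<^sup>2 \<le> 2 * (norm a)\<^sup>2 + 2 * (norm (b::'b::real_inner))\<^sup>2"
proof -
  have "0 \<le> (norm (a - b))\<^sup>2" by simp
  then show ?thesis
    by (simp add: power2_norm_eq_inner inner_simps inner_commute)
qed

lemma abs_inner_le: "\<bar>a \<bullet> b\<bar> \<le> (norm a)\<^sup>2 + (norm (b::'b::real_inner))\<^sup>2"
proof -
  have "\<bar>a \<bullet> b\<bar> \<le> norm a * norm b" by (rule Cauchy_Schwarz_ineq2)
  also have "\<dots> \<le> (norm a)\<^sup>2 + (norm b)\<^sup>2"
    using sum_squares_bound[of "norm a" "norm b"] mult_nonneg_nonneg[OF norm_ge_zero norm_ge_zero, of a b]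
    by linarith
  finally show ?thesis .
qed

lemma sqint_add: "sqint \<mu> f \<Longrightarrow> sqint \<mu> g \<Longrightarrow> sqint \<mu> (\<lambda>z. f z + g z)"
  by (rule sqintI_bound[where g="\<lambda>z. 2 * (norm (f z))\<^sup>2 + 2 * (norm (g z))\<^sup>2"])
     (auto simp: sqint_def norm_add_sq_le)

lemma sqint_linear:
  assumes h: "bounded_linear h" and f: "sqint \<mu> f"
  shows "sqint \<mu> (\<lambda>z. h (f z))"
proof -
  obtain c where c: "\<And>x. norm (h x) \<le> norm x * c"
    using bounded_linear.bounded[OF h] by blast
  have m: "h \<in> borel_measurable borel"
    using h by (intro borel_measurable_continuous_onI linear_continuous_on)
  show ?thesis
  proof (rule sqintI_bound[where g="\<lambda>z. c\<^sup>2 * (norm (f z))\<^sup>2"])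
    show "(\<lambda>z. h (f z)) \<in> borel_measurable \<mu>"
      using measurable_compose[OF sqint_measurable[OF f] m] .
    show "integrable \<mu> (\<lambda>z. c\<^sup>2 * (norm (f z))\<^sup>2)" using f by (auto simp: sqint_def)
    show "(norm (h (f z)))\<^sup>2 \<le> c\<^sup>2 * (norm (f z))\<^sup>2" for z
      using power_mono[OF c[of "f z"], of 2] by (simp add: power_mult_distrib mult.commute)
  qed
qed

lemma sqint_diff: "sqint \<mu> f \<Longrightarrow> sqint \<mu> g \<Longrightarrow> sqint \<mu> (\<lambda>z. f z - g z)"
  using sqint_add[of \<mu> f "\<lambda>z. - g z"] sqint_linear[of uminus \<mu> g]
  by (simp add: bounded_linear_minus[OF bounded_linear_ident])

lemma sqint_sum: "(\<And>i. i \<in> I \<Longrightarrow> sqint \<mu> (f i)) \<Longrightarrow> sqint \<mu> (\<lambda>z. \<Sum>i\<in>I. f i z)"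
proof (induction I rule: infinite_finite_induct)
  case (insert i I) then show ?case by (simp add: sqint_add)
qed (auto simp: sqint_def)

lemma integrable_inner:
  assumes "sqint \<mu> f" "sqint \<mu> g"
  shows "integrable \<mu> (\<lambda>z. f z \<bullet> g z)"
proof (rule Bochner_Integration.integrable_bound[where f="\<lambda>z. (norm (f z))\<^sup>2 + (norm (g z))\<^sup>2"])
  show "(\<lambda>z. f z \<bullet> g z) \<in> borel_measurable \<mu>"
    using assms by (intro borel_measurable_inner sqint_measurable)
qed (use assms in \<open>auto simp: sqint_def intro!: AE_I2 order_trans[OF abs_inner_le]\<close>)

lemma sqint_scaleR_bounded:
  fixes \<zeta> :: "'a \<Rightarrow> real" and f :: "'a \<Rightarrow> 'b::euclidean_space"
  assumes "sqint \<mu> \<zeta>" "f \<in> borel_measurable \<mu>" "\<And>z. z \<in> space \<mu> \<Longrightarrow> norm (f z) \<le> c"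
  shows "sqint \<mu> (\<lambda>z. \<zeta> z *\<^sub>R f z)"
proof (rule sqintI_bound[where g="\<lambda>z. (\<zeta> z)\<^sup>2 * c\<^sup>2"])
  show "(\<lambda>z. \<zeta> z *\<^sub>R f z) \<in> borel_measurable \<mu>"
    using assms by (intro borel_measurable_scaleR) (auto simp: sqint_def)
  show "integrable \<mu> (\<lambda>z. (\<zeta> z)\<^sup>2 * c\<^sup>2)" using assms(1) by (simp add: sqint_def)
  show "(norm (\<zeta> z *\<^sub>R f z))\<^sup>2 \<le> (\<zeta> z)\<^sup>2 * c\<^sup>2" if "z \<in> space \<mu>" for z
    using assms(3)[OF that] by (simp add: power_mult_distrib mult_left_mono power_mono)
qed

lemma (in finite_measure) sqint_integrable:
  fixes f :: "'a \<Rightarrow> real"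
  shows "sqint M f \<Longrightarrow> integrable M f"
  using integrable_inner[of M f "\<lambda>_. 1"] by (simp add: sqint_def)

lemma sqint_cong_AE:
  assumes "sqint \<mu> f" "g \<in> borel_measurable \<mu>" "AE z in \<mu>. f z = g z"
  shows "sqint \<mu> g"
proof -
  have f: "f \<in> borel_measurable \<mu>" "integrable \<mu> (\<lambda>z. (norm (f z))\<^sup>2)"
    using assms(1) by (auto simp: sqint_def)
  have "integrable \<mu> (\<lambda>z. (norm (g z))\<^sup>2)"
    by (rule integrable_cong_AE_imp[OF f(2)]) (use assms in \<open>auto elim: eventually_mono\<close>)
  then show ?thesis using assms(2) by (simp add: sqint_def)
qed

lemma integral_inner_sum:
  fixes f :: "'k \<Rightarrow> 'c \<Rightarrow> 'b::euclidean_space"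
  assumes "bounded_linear h" "\<And>k. k \<in> I \<Longrightarrow> sqint \<mu> (f k)" "\<And>l. l \<in> J \<Longrightarrow> sqint \<mu> (g l)"
  shows "(LINT z|\<mu>. (\<Sum>k\<in>I. f k z) \<bullet> h (\<Sum>l\<in>J. g l z)) = (\<Sum>k\<in>I. \<Sum>l\<in>J. LINT z|\<mu>. f k z \<bullet> h (g l z))"
proof -
  have i: "integrable \<mu> (\<lambda>z. f k z \<bullet> h (g l z))" if "k \<in> I" "l \<in> J" for k l
    by (rule integrable_inner[OF assms(2)[OF that(1)] sqint_linear[OF assms(1) assms(3)[OF that(2)]]])
  have "(\<lambda>z. (\<Sum>k\<in>I. f k z) \<bullet> h (\<Sum>l\<in>J. g l z)) = (\<lambda>z. \<Sum>k\<in>I. \<Sum>l\<in>J. f k z \<bullet> h (g l z))"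
    unfolding linear_sum[OF bounded_linear.linear[OF assms(1)]] inner_sum_left inner_sum_right
    by (rule ext) (rule sum.swap)
  then show ?thesis
    using i by (simp add: Bochner_Integration.integral_sum Bochner_Integration.integrable_sum del: Bochner_Integration.integral_inner_left Bochner_Integration.integral_inner_right)
qed

lemma L2_Cauchy_Schwarz:
  assumes f: "sqint \<mu> f" and g: "sqint \<mu> g"
  shows "\<bar>LINT z|\<mu>. f z \<bullet> g z\<bar> \<le> sqrt (LINT z|\<mu>. (norm (f z))\<^sup>2) * sqrt (LINT z|\<mu>. (norm (g z))\<^sup>2)"
proof -
  have [measurable]: "f \<in> borel_measurable \<mu>" "g \<in> borel_measurable \<mu>"
    using f g by (auto simp: sqint_def)
  let ?p = "\<lambda>z. norm (f z) * norm (g z)"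
  have ip: "integrable \<mu> ?p"
    using integrable_inner[of \<mu> "\<lambda>z. norm (f z)" "\<lambda>z. norm (g z)"] f g by (simp add: sqint_def)
  have "\<bar>LINT z|\<mu>. f z \<bullet> g z\<bar> \<le> (LINT z|\<mu>. \<bar>f z \<bullet> g z\<bar>)"
    by simp
  also have "\<dots> \<le> (LINT z|\<mu>. ?p z)"
    using integrable_inner[OF f g] ip
    by (intro integral_mono) (auto intro: Cauchy_Schwarz_ineq2)
  finally have 1: "\<bar>LINT z|\<mu>. f z \<bullet> g z\<bar> \<le> (LINT z|\<mu>. ?p z)" .
  have "(\<integral>\<^sup>+z. ennreal (norm (f z)) * ennreal (norm (g z)) \<partial>\<mu>)\<^sup>2 \<le>
     (\<integral>\<^sup>+z. (ennreal (norm (f z)))\<^sup>2 \<partial>\<mu>) * (\<integral>\<^sup>+z. (ennreal (norm (g z)))\<^sup>2 \<partial>\<mu>)"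
    by (rule Cauchy_Schwarz_nn_integral) auto
  moreover have "(\<integral>\<^sup>+z. ennreal (norm (f z)) * ennreal (norm (g z)) \<partial>\<mu>) = ennreal (LINT z|\<mu>. ?p z)"
    using ip by (subst nn_integral_eq_integral[symmetric]) (auto simp: ennreal_mult')
  ultimately have "(ennreal (LINT z|\<mu>. ?p z))\<^sup>2 \<le>
      ennreal (LINT z|\<mu>. (norm (f z))\<^sup>2) * ennreal (LINT z|\<mu>. (norm (g z))\<^sup>2)"
    using f g by (simp add: nn_integral_eq_integral sqint_def ennreal_power)
  then have "ennreal ((LINT z|\<mu>. ?p z)\<^sup>2) \<le>
      ennreal ((LINT z|\<mu>. (norm (f z))\<^sup>2) * (LINT z|\<mu>. (norm (g z))\<^sup>2))"
    by (subst ennreal_power[symmetric], simp, subst ennreal_mult) auto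
  then have "(LINT z|\<mu>. ?p z)\<^sup>2 \<le> (LINT z|\<mu>. (norm (f z))\<^sup>2) * (LINT z|\<mu>. (norm (g z))\<^sup>2)"
    by (subst (asm) ennreal_le_iff) auto
  then have "(LINT z|\<mu>. ?p z) \<le> sqrt ((LINT z|\<mu>. (norm (f z))\<^sup>2) * (LINT z|\<mu>. (norm (g z))\<^sup>2))"
    by (rule real_le_rsqrt)
  then show ?thesis using 1 by (simp add: real_sqrt_mult)
qed

definition L2lim :: "'a measure \<Rightarrow> (nat \<Rightarrow> 'a \<Rightarrow> 'b::euclidean_space) \<Rightarrow> ('a \<Rightarrow> 'b) \<Rightarrow> bool" where
  "L2lim \<mu> f g \<longleftrightarrow> (\<forall>j. sqint \<mu> (f j)) \<and> sqint \<mu> g \<and>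
     (\<lambda>j. LINT z|\<mu>. (norm (f j z - g z))\<^sup>2) \<longlonglongrightarrow> 0"

lemma L2lim_const: "sqint \<mu> f \<Longrightarrow> L2lim \<mu> (\<lambda>_. f) f"
  by (simp add: L2lim_def)

lemma L2lim_linear:
  assumes h: "bounded_linear h" and f: "L2lim \<mu> f g"
  shows "L2lim \<mu> (\<lambda>j z. h (f j z)) (\<lambda>z. h (g z))"
proof -
  obtain c where c: "\<And>x. norm (h x) \<le> norm x * c"
    using bounded_linear.bounded[OF h] by blast
  have d: "sqint \<mu> (\<lambda>z. f j z - g z)" for j using f by (auto simp: L2lim_def intro: sqint_diff)
  have "(\<lambda>j. LINT z|\<mu>. (norm (h (f j z) - h (g z)))\<^sup>2) \<longlonglongrightarrow> 0"
  proof (rule tendsto_sandwich[where f="\<lambda>_. 0" and h="\<lambda>j. c\<^sup>2 * (LINT z|\<mu>. (norm (f j z - g z))\<^sup>2)"])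
    have "(LINT z|\<mu>. (norm (h (f j z) - h (g z)))\<^sup>2) \<le> (LINT z|\<mu>. c\<^sup>2 * (norm (f j z - g z))\<^sup>2)" for j
    proof (rule integral_mono)
      show "integrable \<mu> (\<lambda>z. (norm (h (f j z) - h (g z)))\<^sup>2)"
        using sqint_linear[OF h d[of j]] by (simp add: sqint_def linear_diff[OF bounded_linear.linear[OF h]])
      show "integrable \<mu> (\<lambda>z. c\<^sup>2 * (norm (f j z - g z))\<^sup>2)"
        using d[of j] by (simp add: sqint_def)
      show "(norm (h (f j z) - h (g z)))\<^sup>2 \<le> c\<^sup>2 * (norm (f j z - g z))\<^sup>2" for z
        using power_mono[OF c[of "f j z - g z"], of 2]
        by (simp add: power_mult_distrib mult.commute linear_diff[OF bounded_linear.linear[OF h]])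
    qed
    then show "\<forall>\<^sub>F j in sequentially. (LINT z|\<mu>. (norm (h (f j z) - h (g z)))\<^sup>2)
        \<le> c\<^sup>2 * (LINT z|\<mu>. (norm (f j z - g z))\<^sup>2)" by simp
    show "(\<lambda>j. c\<^sup>2 * (LINT z|\<mu>. (norm (f j z - g z))\<^sup>2)) \<longlonglongrightarrow> 0"
      using f by (auto simp: L2lim_def intro: tendsto_mult_right_zero)
  qed auto
  then show ?thesis using f by (auto simp: L2lim_def intro: sqint_linear[OF h])
qed

text \<open>
  Continuity of the \<open>L\<^sup>2\<close> inner product. Every identity between expectations that is proved for simple
  integrands is carried over to general integrands by this lemma.
\<close>
lemma L2lim_inner:
  assumes f: "L2lim \<mu> f f'" and g: "L2lim \<mu> g g'"
  shows "(\<lambda>j. LINT z|\<mu>. f j z \<bullet> g j z) \<longlonglongrightarrow> (LINT z|\<mu>. f' z \<bullet> g' z)"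
proof -
  let ?q = "\<lambda>h. sqrt (LINT z|\<mu>. (norm (h z))\<^sup>2)"
  let ?a = "\<lambda>j z. f j z - f' z" and ?b = "\<lambda>j z. g j z - g' z"
  have s: "sqint \<mu> (f j)" "sqint \<mu> (g j)" "sqint \<mu> f'" "sqint \<mu> g'" for j
    using f g by (auto simp: L2lim_def)
  have d: "sqint \<mu> (?a j)" "sqint \<mu> (?b j)" for j using s by (auto intro: sqint_diff)
  have "(\<lambda>j. (LINT z|\<mu>. f j z \<bullet> g j z) - (LINT z|\<mu>. f' z \<bullet> g' z)) \<longlonglongrightarrow> 0"
  proof (rule Lim_null_comparison)
    have "\<bar>(LINT z|\<mu>. f j z \<bullet> g j z) - (LINT z|\<mu>. f' z \<bullet> g' z)\<bar>
        \<le> ?q (?a j) * ?q (?b j) + (?q (?a j) * ?q g' + ?q f' * ?q (?b j))" for j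
    proof -
      have "(LINT z|\<mu>. f j z \<bullet> g j z) - (LINT z|\<mu>. f' z \<bullet> g' z)
          = (LINT z|\<mu>. f j z \<bullet> g j z - f' z \<bullet> g' z)"
        by (rule Bochner_Integration.integral_diff[symmetric]) (auto intro: integrable_inner s)
      also have "\<dots> = (LINT z|\<mu>. ?a j z \<bullet> ?b j z + (?a j z \<bullet> g' z + f' z \<bullet> ?b j z))"
        by (rule Bochner_Integration.integral_cong) (auto simp: inner_simps)
      also have "\<dots> = (LINT z|\<mu>. ?a j z \<bullet> ?b j z) + ((LINT z|\<mu>. ?a j z \<bullet> g' z) + (LINT z|\<mu>. f' z \<bullet> ?b j z))"
        by (subst Bochner_Integration.integral_add, (intro Bochner_Integration.integrable_add integrable_inner s d)+)
           (subst Bochner_Integration.integral_add, (intro integrable_inner s d)+, simp)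
      finally show ?thesis
        using L2_Cauchy_Schwarz[OF d(1) d(2), of j j] L2_Cauchy_Schwarz[OF d(1) s(4), of j]
          L2_Cauchy_Schwarz[OF s(3) d(2), of j] by linarith
    qed
    then show "\<forall>\<^sub>F j in sequentially. norm ((LINT z|\<mu>. f j z \<bullet> g j z) - (LINT z|\<mu>. f' z \<bullet> g' z))
        \<le> ?q (?a j) * ?q (?b j) + (?q (?a j) * ?q g' + ?q f' * ?q (?b j))" by simp
    have "(\<lambda>j. ?q (?a j)) \<longlonglongrightarrow> sqrt 0" "(\<lambda>j. ?q (?b j)) \<longlonglongrightarrow> sqrt 0"
      by (intro tendsto_real_sqrt; use f g in \<open>simp add: L2lim_def\<close>)+
    then have "(\<lambda>j. ?q (?a j) * ?q (?b j) + (?q (?a j) * ?q g' + ?q f' * ?q (?b j)))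
        \<longlonglongrightarrow> sqrt 0 * sqrt 0 + (sqrt 0 * ?q g' + ?q f' * sqrt 0)"
      by (intro tendsto_add tendsto_mult tendsto_const)
    then show "(\<lambda>j. ?q (?a j) * ?q (?b j) + (?q (?a j) * ?q g' + ?q f' * ?q (?b j))) \<longlonglongrightarrow> 0"
      by simp
  qed
  then show ?thesis by (rule LIM_zero_cancel)
qed

lemma sqint_nn:
  assumes "f \<in> borel_measurable \<mu>"
  shows "sqint \<mu> f \<longleftrightarrow> (\<integral>\<^sup>+z. ennreal ((norm (f z))\<^sup>2) \<partial>\<mu>) < \<infinity>"
  using assms by (auto simp: sqint_def integrable_iff_bounded)

text \<open>
  The limits in the definition of the stochastic integral are stated with nonnegative integrals, which may be
  infinite. Since they tend to zero they are finite from some index on, and so \<open>g\<close> is square integrable.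
\<close>
lemma L2lim_nnI:
  assumes f: "\<And>j. sqint \<mu> (f j)" and g: "g \<in> borel_measurable \<mu>"
    and lim: "(\<lambda>j. \<integral>\<^sup>+z. ennreal ((norm (g z - f j z))\<^sup>2) \<partial>\<mu>) \<longlonglongrightarrow> 0"
  shows "L2lim \<mu> f g"
proof -
  have "\<forall>\<^sub>F j in sequentially. (\<integral>\<^sup>+z. ennreal ((norm (g z - f j z))\<^sup>2) \<partial>\<mu>) < \<infinity>"
    using order_tendstoD(2)[OF lim, of \<infinity>] by simp
  then obtain j where "(\<integral>\<^sup>+z. ennreal ((norm (g z - f j z))\<^sup>2) \<partial>\<mu>) < \<infinity>"
    by (auto simp: eventually_sequentially)
  moreover have "f i \<in> borel_measurable \<mu>" for i using f by (simp add: sqint_def)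
  ultimately have "sqint \<mu> (\<lambda>z. g z - f j z)"
    using g by (subst sqint_nn) auto
  from sqint_add[OF this f[of j]] have g': "sqint \<mu> g" by simp
  have "(\<integral>\<^sup>+z. ennreal ((norm (g z - f j z))\<^sup>2) \<partial>\<mu>) = ennreal (LINT z|\<mu>. (norm (f j z - g z))\<^sup>2)" for j
    using sqint_diff[OF g' f[of j]]
    by (subst nn_integral_eq_integral) (auto simp: sqint_def norm_minus_commute)
  with lim have "(\<lambda>j. ennreal (LINT z|\<mu>. (norm (f j z - g z))\<^sup>2)) \<longlonglongrightarrow> ennreal 0" by simp
  then have "(\<lambda>j. LINT z|\<mu>. (norm (f j z - g z))\<^sup>2) \<longlonglongrightarrow> 0"
    by (subst (asm) tendsto_ennreal_iff) auto
  then show ?thesis using f g' by (simp add: L2lim_def)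
qed

section \<open>Increments of the Wiener process\<close>

lemma (in prob_space) indep_set_mono:
  "indep_set U V \<Longrightarrow> U' \<subseteq> U \<Longrightarrow> V' \<subseteq> V \<Longrightarrow> indep_set U' V'"
  unfolding indep_sets2_eq by (intro conjI ballI; use subsetD in blast)

locale wiener_setting = prob_space M for M :: "'a measure" +
  fixes F :: "real \<Rightarrow> 'a measure" and w :: "real \<Rightarrow> 'a \<Rightarrow> real ^ 'q" and K :: "real ^ 'q ^ 'q"
  assumes filtration: "usual_filtration M F" and wiener: "wiener_process M F K w"
begin

lemma subalgebra_F: "0 \<le> t \<Longrightarrow> subalgebra M (F t)"
  using filtration by (simp add: usual_filtration_def)

lemma measurable_F: "0 \<le> t \<Longrightarrow> f \<in> borel_measurable (F t) \<Longrightarrow> f \<in> borel_measurable M"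
  by (rule measurable_from_subalg[OF subalgebra_F])

lemma measurable_F_mono:
  assumes "0 \<le> s" "s \<le> t" "f \<in> borel_measurable (F s)"
  shows "f \<in> borel_measurable (F t)"
proof (rule measurable_from_subalg[OF _ assms(3)])
  have "sets (F s) \<subseteq> sets (F t)"
    using filtration assms(1,2) unfolding usual_filtration_def by blast
  moreover have "space (F s) = space M" "space (F t) = space M"
    using subalgebra_F[of s] subalgebra_F[of t] assms(1,2) by (simp_all add: subalgebra_def)
  ultimately show "subalgebra (F t) (F s)"
    by (simp add: subalgebra_def)
qed

lemma w_measurable: "0 \<le> t \<Longrightarrow> w t \<in> borel_measurable (F t)"
  using wiener by (simp add: wiener_process_def)

lemma w_component_measurable: "0 \<le> t \<Longrightarrow> (\<lambda>\<omega>. w t \<omega> $ i) \<in> borel_measurable (F t)"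
  by (rule measurable_compose[OF w_measurable])
     (auto intro!: borel_measurable_continuous_onI continuous_intros)

definition inc :: "'q \<Rightarrow> real \<Rightarrow> real \<Rightarrow> 'a \<Rightarrow> real" where
  "inc i s t \<omega> = w t \<omega> $ i - w s \<omega> $ i"

lemma inc_self: "inc i t t \<omega> = 0"
  by (simp add: inc_def)

lemma inc_measurable: "0 \<le> s \<Longrightarrow> s \<le> t \<Longrightarrow> inc i s t \<in> borel_measurable (F t)"
  unfolding inc_def[abs_def]
  using w_component_measurable[of t i] measurable_F_mono[OF _ _ w_component_measurable[of s i], of t]
  by (intro borel_measurable_diff) auto

lemma inc_gaussian_moments:
  assumes "0 \<le> s" "s \<le> t"
  shows "integrable M (\<lambda>\<omega>. (inc i s t \<omega>)\<^sup>2)" and "expectation (inc i s t) = 0"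
proof -
  have m[measurable]: "inc i s t \<in> borel_measurable M"
    using assms inc_measurable measurable_F[of t] by auto
  have eq: "(\<lambda>\<omega>. axis i 1 \<bullet> (w t \<omega> - w s \<omega>)) = inc i s t"
    by (simp add: fun_eq_iff inc_def inner_axis')
  have "centred_gaussian M (\<lambda>\<omega>. w t \<omega> - w s \<omega>)"
    using wiener assms by (simp add: wiener_process_def)
  then have "\<exists>\<sigma>\<ge>0. distr M borel (\<lambda>\<omega>. axis i 1 \<bullet> (w t \<omega> - w s \<omega>)) =
      (if \<sigma> = 0 then return borel 0 else density lborel (normal_density 0 \<sigma>))"
    unfolding centred_gaussian_def by blast
  then obtain \<sigma> where "0 \<le> \<sigma>" and d: "distr M borel (inc i s t) =
      (if \<sigma> = 0 then return borel 0 else density lborel (normal_density 0 \<sigma>))"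
    unfolding eq by blast
  have "integrable (distr M borel (inc i s t)) (\<lambda>x. x\<^sup>2) \<and>
        (LINT x|distr M borel (inc i s t). x) = 0"
  proof (cases "\<sigma> = 0")
    case True
    have "integrable (return borel (0::real)) (\<lambda>x. x\<^sup>2)"
      by (simp add: integrable_iff_bounded nn_integral_return)
    moreover have "(LINT x|return borel (0::real). x) = 0"
      by (simp add: integral_return)
    ultimately show ?thesis using True d by simp
  next
    case False
    then have "0 < \<sigma>" using \<open>0 \<le> \<sigma>\<close> by simp
    then show ?thesis
      using integrable_normal_moment[of \<sigma> 0 2] integral_normal_moment_nz_1[of \<sigma> 0] d False
      by (simp add: integrable_density integral_density)
  qed
  then show "integrable M (\<lambda>\<omega>. (inc i s t \<omega>)\<^sup>2)" "expectation (inc i s t) = 0"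
    by (simp_all add: integrable_distr_eq integral_distr)
qed

lemma inc_sqint: "0 \<le> s \<Longrightarrow> s \<le> t \<Longrightarrow> sqint M (inc i s t)"
  using inc_gaussian_moments(1)[of s t i] measurable_F[OF _ inc_measurable, of t s i] by (simp add: sqint_def)

lemma inc_covariance:
  "0 \<le> s \<Longrightarrow> s \<le> t \<Longrightarrow> expectation (\<lambda>\<omega>. inc i s t \<omega> * inc j s t \<omega>) = (t - s) * K $ i $ j"
  using wiener by (simp add: wiener_process_def inc_def)

lemma covariance_symmetric: "K $ i $ j = K $ j $ i"
  using inc_covariance[of 0 1 i j] inc_covariance[of 0 1 j i] by (simp add: mult.commute)

text \<open>
  The increment is assumed independent of the past as a family of events. Every variable known at time \<open>s\<close> is
  therefore independent of every measurable function of the increment.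
\<close>
lemma expectation_past_times_increment:
  fixes \<zeta> :: "'a \<Rightarrow> real" and g :: "real ^ 'q \<Rightarrow> real"
  assumes st: "0 \<le> s" "s \<le> t" and z: "\<zeta> \<in> borel_measurable (F s)" "integrable M \<zeta>"
    and g: "g \<in> borel_measurable borel" "integrable M (\<lambda>\<omega>. g (w t \<omega> - w s \<omega>))"
  shows "integrable M (\<lambda>\<omega>. \<zeta> \<omega> * g (w t \<omega> - w s \<omega>))"
    and "expectation (\<lambda>\<omega>. \<zeta> \<omega> * g (w t \<omega> - w s \<omega>)) = expectation \<zeta> * expectation (\<lambda>\<omega>. g (w t \<omega> - w s \<omega>))"
proof -
  let ?D = "\<lambda>\<omega>. w t \<omega> - w s \<omega>"
  have D: "?D \<in> borel_measurable M"
    using w_measurable[of s] w_measurable[of t] measurable_F[of s] measurable_F[of t] st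
    by (intro borel_measurable_diff) auto
  have zM: "\<zeta> \<in> borel_measurable M" using z(2) by auto
  have sp: "space (F s) = space M" using subalgebra_F[OF st(1)] by (simp add: subalgebra_def)
  have "{\<zeta> -` C \<inter> space M | C. C \<in> sets borel} \<subseteq> sets (F s)"
    using measurable_sets[OF z(1)] sp by auto
  then have 1: "sigma_sets (space M) {\<zeta> -` C \<inter> space M | C. C \<in> sets borel} \<subseteq> sets (F s)"
    using sets.sigma_sets_subset[of _ "F s"] sp by simp
  \<comment> \<open>The preimages under the increment already form a \<open>\<sigma>\<close>-algebra, so generating one adds nothing.\<close>
  have D_space: "?D \<in> space M \<rightarrow> space borel" by simp
  have 2: "sigma_sets (space M) {?D -` C \<inter> space M | C. C \<in> sets borel}
      \<subseteq> {?D -` C \<inter> space M | C. C \<in> sets borel}"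
    using sets.sigma_sets_eq[of "vimage_algebra (space M) ?D borel"]
    unfolding sets_vimage_algebra2[OF D_space] space_vimage_algebra by (rule equalityD1)
  have "{(\<lambda>\<omega>. g (?D \<omega>)) -` C \<inter> space M | C. C \<in> sets borel}
      \<subseteq> {?D -` C \<inter> space M | C. C \<in> sets borel}"
  proof
    fix S assume "S \<in> {(\<lambda>\<omega>. g (?D \<omega>)) -` C \<inter> space M | C. C \<in> sets borel}"
    then obtain C where "C \<in> sets borel" "S = ?D -` (g -` C) \<inter> space M" by auto
    then show "S \<in> {?D -` C \<inter> space M | C. C \<in> sets borel}"
      using measurable_sets[OF g(1), of C] by auto
  qed
  then have 3: "sigma_sets (space M) {(\<lambda>\<omega>. g (?D \<omega>)) -` C \<inter> space M | C. C \<in> sets borel}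
      \<subseteq> {?D -` C \<inter> space M | C. C \<in> sets borel}"
    using 2 by (meson sigma_sets_mono' subset_trans)
  have "indep_set (sets (F s)) {?D -` C \<inter> space M | C. C \<in> sets borel}"
    using wiener st by (simp add: wiener_process_def)
  then have indep: "indep_set (sigma_sets (space M) {\<zeta> -` C \<inter> space M | C. C \<in> sets borel})
      (sigma_sets (space M) {(\<lambda>\<omega>. g (?D \<omega>)) -` C \<inter> space M | C. C \<in> sets borel})"
    using 1 3 by (rule indep_set_mono)
  have "indep_var borel \<zeta> borel (\<lambda>\<omega>. g (?D \<omega>))"
    unfolding indep_var_eq using indep zM measurable_compose[OF D g(1)] by simp
  then show "integrable M (\<lambda>\<omega>. \<zeta> \<omega> * g (?D \<omega>))"
    "expectation (\<lambda>\<omega>. \<zeta> \<omega> * g (?D \<omega>)) = expectation \<zeta> * expectation (\<lambda>\<omega>. g (?D \<omega>))"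
    using indep_var_integrable[OF _ z(2) g(2)] indep_var_lebesgue_integral[OF _ z(2) g(2)] by simp_all
qed

lemma past_times_inc:
  assumes "0 \<le> s" "s \<le> t" and "\<zeta> \<in> borel_measurable (F s)" "integrable M \<zeta>"
  shows "integrable M (\<lambda>\<omega>. \<zeta> \<omega> * inc i s t \<omega>)" and "expectation (\<lambda>\<omega>. \<zeta> \<omega> * inc i s t \<omega>) = 0"
proof -
  have "integrable M (inc i s t)"
    using inc_sqint[OF assms(1,2), of i] integrable_inner[of M "inc i s t" "\<lambda>_. 1"]
    by (simp add: sqint_def)
  then show "integrable M (\<lambda>\<omega>. \<zeta> \<omega> * inc i s t \<omega>)" "expectation (\<lambda>\<omega>. \<zeta> \<omega> * inc i s t \<omega>) = 0"
    using expectation_past_times_increment[OF assms, of "\<lambda>v. v $ i"] inc_gaussian_moments(2)[OF assms(1,2), of i]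
    by (simp_all add: inc_def[abs_def])
qed

lemma past_times_inc_inc:
  assumes "0 \<le> s" "s \<le> t" and "\<zeta> \<in> borel_measurable (F s)" "integrable M \<zeta>"
  shows "integrable M (\<lambda>\<omega>. \<zeta> \<omega> * (inc i s t \<omega> * inc j s t \<omega>))"
    and "expectation (\<lambda>\<omega>. \<zeta> \<omega> * (inc i s t \<omega> * inc j s t \<omega>)) = K $ i $ j * ((t - s) * expectation \<zeta>)"
proof -
  have "integrable M (\<lambda>\<omega>. inc i s t \<omega> * inc j s t \<omega>)"
    using integrable_inner[OF inc_sqint inc_sqint] assms(1,2) by simp
  then show "integrable M (\<lambda>\<omega>. \<zeta> \<omega> * (inc i s t \<omega> * inc j s t \<omega>))"
    "expectation (\<lambda>\<omega>. \<zeta> \<omega> * (inc i s t \<omega> * inc j s t \<omega>)) = K $ i $ j * ((t - s) * expectation \<zeta>)"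
    using expectation_past_times_increment[OF assms, of "\<lambda>v. v $ i * v $ j"] inc_covariance[OF assms(1,2), of i j]
    by (simp_all add: inc_def[abs_def])
qed

section \<open>Covariance of increments\<close>

sublocale Q: pair_sigma_finite lborel M ..

lemma sqint_bounded_times_inc:
  assumes "0 \<le> s" "s \<le> t" "\<zeta> \<in> borel_measurable M" "\<And>\<omega>. \<omega> \<in> space M \<Longrightarrow> \<bar>\<zeta> \<omega>\<bar> \<le> C"
  shows "sqint M (\<lambda>\<omega>. \<zeta> \<omega> * inc i s t \<omega>)"
  using sqint_scaleR_bounded[OF inc_sqint[OF assms(1,2), of i], of \<zeta> C] assms(3,4)
  by (simp add: mult.commute)

text \<open>
  If the intervals are disjoint, the second increment comes after all other factors, and the expectation is
  zero. If they overlap, both increments are split at the points \<open>c\<close> and \<open>m = min b d\<close>. The increments over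
  the common interval \<open>(c,m]\<close> contribute its length. Every other product either contains an increment that
  comes after all remaining factors, or contains the increment over one of \<open>(m,b]\<close>, \<open>(m,d]\<close> that is empty.
\<close>
lemma covariance_of_increments_ordered:
  assumes "0 \<le> a" "a \<le> b" "a \<le> c" "c \<le> d"
    and zc: "\<zeta> \<in> borel_measurable (F c)" and bd: "\<And>\<omega>. \<omega> \<in> space M \<Longrightarrow> \<bar>\<zeta> \<omega>\<bar> \<le> C"
  shows "integrable M (\<lambda>\<omega>. \<zeta> \<omega> * (inc i a b \<omega> * inc j c d \<omega>)) \<and>
    expectation (\<lambda>\<omega>. \<zeta> \<omega> * (inc i a b \<omega> * inc j c d \<omega>)) =
      K $ i $ j * (measure lborel ({a<..b} \<inter> {c<..d}) * expectation \<zeta>)"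
proof -
  have zM: "\<zeta> \<in> borel_measurable M" using zc measurable_F[of c] assms by simp
  have iz: "integrable M \<zeta>"
    using bd zM by (intro integrable_const_bound[where B=C]) auto
  have past: "(\<lambda>\<omega>. \<zeta> \<omega> * inc k r s \<omega>) \<in> borel_measurable (F s)"
    "integrable M (\<lambda>\<omega>. \<zeta> \<omega> * inc k r s \<omega>)" if "0 \<le> r" "r \<le> s" "c \<le> s" for k r s
  proof -
    show "(\<lambda>\<omega>. \<zeta> \<omega> * inc k r s \<omega>) \<in> borel_measurable (F s)"
      using that assms measurable_F_mono[OF _ _ zc, of s] inc_measurable[of r s k]
      by (intro borel_measurable_times) auto
    show "integrable M (\<lambda>\<omega>. \<zeta> \<omega> * inc k r s \<omega>)"
      using sqint_bounded_times_inc[OF that(1,2) zM bd] by (rule sqint_integrable)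
  qed
  show ?thesis
  proof (cases "b \<le> c")
    case True
    have "inc i a b \<in> borel_measurable (F c)"
      by (rule measurable_F_mono[OF _ True inc_measurable]) (use assms in auto)
    then have m: "(\<lambda>\<omega>. \<zeta> \<omega> * inc i a b \<omega>) \<in> borel_measurable (F c)"
      using zc by (intro borel_measurable_times)
    have "integrable M (\<lambda>\<omega>. \<zeta> \<omega> * inc i a b \<omega>)"
      using sqint_bounded_times_inc[OF assms(1,2) zM bd] by (rule sqint_integrable)
    from past_times_inc[OF _ _ m this, of d j] have
      "integrable M (\<lambda>\<omega>. \<zeta> \<omega> * inc i a b \<omega> * inc j c d \<omega>)"
      "expectation (\<lambda>\<omega>. \<zeta> \<omega> * inc i a b \<omega> * inc j c d \<omega>) = 0" using assms by auto
    moreover have "{a<..b} \<inter> {c<..d} = {}" using True by auto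
    ultimately show ?thesis unfolding mult.assoc by (simp only: measure_empty) simp
  next
    case False
    define m where "m = min b d"
    have m: "c \<le> m" "m \<le> b" "m \<le> d" "b = m \<or> d = m" using False assms by (auto simp: m_def)
    have c0: "0 \<le> c" using assms by simp
    have m0: "0 \<le> m" using c0 m by simp
    note t1 = past_times_inc[OF c0 assms(4) past[OF assms(1,3) order_refl], of i j]
    note t2 = past_times_inc_inc[OF c0 m(1) zc iz, of i j]
    note t3 = past_times_inc[OF m0 m(3) past[OF c0 m(1) m(1)], of i j]
    note t4 = past_times_inc[OF m0 m(2) past[OF c0 m(1) m(1)], of j i]
    \<comment> \<open>The product of the increments over \<open>(m,b]\<close> and \<open>(m,d]\<close> is absent since one of them is zero.\<close>
    have eq: "\<zeta> \<omega> * (inc i a b \<omega> * inc j c d \<omega>) =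
       \<zeta> \<omega> * inc i a c \<omega> * inc j c d \<omega> + (\<zeta> \<omega> * (inc i c m \<omega> * inc j c m \<omega>) +
       (\<zeta> \<omega> * inc i c m \<omega> * inc j m d \<omega> + \<zeta> \<omega> * inc j c m \<omega> * inc i m b \<omega>))" for \<omega>
      using m(4) by (auto simp: inc_def algebra_simps)
    have "{a<..b} \<inter> {c<..d} = {c<..m}" using assms m by (auto simp: m_def)
    then have "measure lborel ({a<..b} \<inter> {c<..d}) = m - c" using m(1) by simp
    then show ?thesis
      unfolding eq using t1 t2 t3 t4 by simp
  qed
qed

text \<open>
  The length of the common interval is the time integral of the product of the two indicator functions. This
  is the source of the isometry for simple integrands, which may be defined on two unrelated partitions.
\<close>
lemma covariance_of_increments:
  assumes "0 \<le> a" "a \<le> b" "0 \<le> c" "c \<le> d"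
    and z: "\<zeta> \<in> borel_measurable (F (max a c))" and bd: "\<And>\<omega>. \<omega> \<in> space M \<Longrightarrow> \<bar>\<zeta> \<omega>\<bar> \<le> C"
  shows "integrable M (\<lambda>\<omega>. \<zeta> \<omega> * (inc i a b \<omega> * inc j c d \<omega>))"
    and "expectation (\<lambda>\<omega>. \<zeta> \<omega> * (inc i a b \<omega> * inc j c d \<omega>)) =
      K $ i $ j * (measure lborel ({a<..b} \<inter> {c<..d}) * expectation \<zeta>)"
proof -
  have "integrable M (\<lambda>\<omega>. \<zeta> \<omega> * (inc i a b \<omega> * inc j c d \<omega>)) \<and>
    expectation (\<lambda>\<omega>. \<zeta> \<omega> * (inc i a b \<omega> * inc j c d \<omega>)) =
      K $ i $ j * (measure lborel ({a<..b} \<inter> {c<..d}) * expectation \<zeta>)"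
  proof (cases "a \<le> c")
    case True
    then show ?thesis
      using covariance_of_increments_ordered[of a b c d \<zeta> C i j] assms by (simp add: max_absorb2)
  next
    case False
    then show ?thesis
      using covariance_of_increments_ordered[of c d a b \<zeta> C j i] assms
      by (simp add: max_absorb1 covariance_symmetric[of j i] Int_commute mult.commute[of "inc j c d _"])
  qed
  then show "integrable M (\<lambda>\<omega>. \<zeta> \<omega> * (inc i a b \<omega> * inc j c d \<omega>))"
    "expectation (\<lambda>\<omega>. \<zeta> \<omega> * (inc i a b \<omega> * inc j c d \<omega>)) =
      K $ i $ j * (measure lborel ({a<..b} \<inter> {c<..d}) * expectation \<zeta>)" by auto
qed

lemma integral_indicator_times:
  fixes \<zeta> :: "'a \<Rightarrow> real"
  assumes A: "A \<in> sets borel" "emeasure lborel A < \<infinity>" and z: "integrable M \<zeta>"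
  shows "integrable (lborel \<Otimes>\<^sub>M M) (\<lambda>(s, \<omega>). indicator A s * \<zeta> \<omega>)"
    and "(LINT (s, \<omega>)|(lborel \<Otimes>\<^sub>M M). indicator A s * \<zeta> \<omega>) = measure lborel A * expectation \<zeta>"
proof -
  have [measurable]: "A \<in> sets borel" "\<zeta> \<in> borel_measurable M" using A z by auto
  show i: "integrable (lborel \<Otimes>\<^sub>M M) (\<lambda>(s, \<omega>). indicator A s * \<zeta> \<omega>)"
  proof (rule Q.Fubini_integrable)
    have "(\<lambda>s. \<integral>\<omega>. norm (case (s, \<omega>) of (s, \<omega>) \<Rightarrow> indicator A s * \<zeta> \<omega>) \<partial>M)
      = (\<lambda>s. indicator A s * expectation (\<lambda>\<omega>. \<bar>\<zeta> \<omega>\<bar>))"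
      by (auto simp: fun_eq_iff abs_mult)
    then show "integrable lborel (\<lambda>s. \<integral>\<omega>. norm (case (s, \<omega>) of (s, \<omega>) \<Rightarrow> indicator A s * \<zeta> \<omega>) \<partial>M)"
      using A by simp
  qed (use z in auto)
  have "(LINT (s, \<omega>)|(lborel \<Otimes>\<^sub>M M). indicator A s * \<zeta> \<omega>) = (LINT s|lborel. indicator A s * expectation \<zeta>)"
    using Q.integral_fst'[OF i] by simp
  then show "(LINT (s, \<omega>)|(lborel \<Otimes>\<^sub>M M). indicator A s * \<zeta> \<omega>) = measure lborel A * expectation \<zeta>"
    using A by simp
qed

end

section \<open>Processes as functions of time and chance\<close>

text \<open>
  Extending by zero instead of restricting the time axis keeps one measure space for all end times \<open>t\<close>.
\<close>
definition cut :: "real \<Rightarrow> (real \<Rightarrow> 'a \<Rightarrow> 'b::euclidean_space) \<Rightarrow> real \<times> 'a \<Rightarrow> 'b" where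
  "cut t f z = indicat_real {0..t} (fst z) *\<^sub>R f (fst z) (snd z)"

context wiener_setting
begin

lemma cut_measurable:
  assumes "f \<in> L2T M F t"
  shows "cut t f \<in> borel_measurable (lborel \<Otimes>\<^sub>M M)"
proof -
  let ?R = "restrict_space (lborel \<Otimes>\<^sub>M M) {z. fst z \<in> {0..t}}"
  have "(\<lambda>z. (fst z, snd z)) \<in> ?R \<rightarrow>\<^sub>M restrict_space borel {0..t} \<Otimes>\<^sub>M M"
  proof (rule measurable_Pair)
    have "fst \<in> (lborel \<Otimes>\<^sub>M M) \<rightarrow>\<^sub>M (borel :: real measure)"
      using measurable_fst[of "lborel :: real measure" M] by simp
    then show "fst \<in> ?R \<rightarrow>\<^sub>M restrict_space borel {0..t}"
      by (intro measurable_restrict_space2 measurable_restrict_space1) (simp_all add: space_restrict_space)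
    show "snd \<in> ?R \<rightarrow>\<^sub>M M"
      by (rule measurable_restrict_space1[OF measurable_snd])
  qed
  from measurable_compose[OF this, of "\<lambda>(s, \<omega>). f s \<omega>"]
  have R: "(\<lambda>z. f (fst z) (snd z)) \<in> borel_measurable ?R"
    using assms unfolding L2T_def mem_Collect_eq prod.case by blast
  have S: "{z \<in> space (lborel \<Otimes>\<^sub>M M). fst z \<in> {0..t}} \<in> sets (lborel \<Otimes>\<^sub>M M)"
    by measurable
  have "(\<lambda>z. if fst z \<in> {0..t} then f (fst z) (snd z) else 0) \<in> borel_measurable (lborel \<Otimes>\<^sub>M M)"
    by (rule measurable_If_restrict_space_iff[OF S, THEN iffD2, OF conjI[OF R]]) simp
  moreover have "cut t f = (\<lambda>z. if fst z \<in> {0..t} then f (fst z) (snd z) else 0)"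
    by (auto simp: cut_def fun_eq_iff)
  ultimately show ?thesis by simp
qed

lemma L2T_norm_sq_cut:
  assumes "cut t f \<in> borel_measurable (lborel \<Otimes>\<^sub>M M)"
  shows "L2T_norm_sq M t f = (\<integral>\<^sup>+z. ennreal ((norm (cut t f z))\<^sup>2) \<partial>(lborel \<Otimes>\<^sub>M M))"
proof -
  have "L2T_norm_sq M t f = (\<integral>\<^sup>+\<omega>. (\<integral>\<^sup>+s. ennreal ((norm (cut t f (s, \<omega>)))\<^sup>2) \<partial>lborel) \<partial>M)"
    unfolding L2T_norm_sq_def
    by (intro nn_integral_cong) (auto simp: cut_def indicator_def)
  also have "\<dots> = (\<integral>\<^sup>+z. ennreal ((norm (cut t f z))\<^sup>2) \<partial>(lborel \<Otimes>\<^sub>M M))"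
    using assms by (intro Q.nn_integral_snd) auto
  finally show ?thesis .
qed

lemma sqint_cut: "f \<in> L2T M F t \<Longrightarrow> sqint (lborel \<Otimes>\<^sub>M M) (cut t f)"
  using cut_measurable[of f t] L2T_norm_sq_cut[of t f] by (simp add: sqint_nn) (simp add: L2T_def)

section \<open>The isometry for simple integrands\<close>

lemma simple_process_times:
  assumes "simple_process M F m \<tau> \<xi>" "k < m"
  shows "0 \<le> \<tau> k" "\<tau> k < \<tau> (Suc k)"
proof -
  have step: "\<And>k. k < m \<Longrightarrow> \<tau> k < \<tau> (Suc k)" and start: "0 \<le> \<tau> 0"
    using assms(1) by (auto simp: simple_process_def)
  show "\<tau> k < \<tau> (Suc k)" using step assms(2) .
  show "0 \<le> \<tau> k"
    using assms(2)
  proof (induction k)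
    case (Suc k)
    then show ?case using step[of k] by simp
  qed (rule start)
qed

lemma simple_process_clamped_times:
  assumes "simple_process M F m \<tau> \<xi>" "k < m" "0 \<le> t"
  shows "0 \<le> min t (\<tau> k)" "min t (\<tau> k) \<le> min t (\<tau> (Suc k))"
  using simple_process_times[OF assms(1,2)] assms(3) by auto

lemma simple_process_coefficient:
  assumes "simple_process M F m \<tau> \<xi>" "k < m"
  shows "\<xi> k \<in> borel_measurable (F (\<tau> k))" "\<xi> k \<in> borel_measurable M"
    and "\<exists>c. \<forall>\<omega>\<in>space M. norm (\<xi> k \<omega>) \<le> c"
proof -
  show 1: "\<xi> k \<in> borel_measurable (F (\<tau> k))" and "\<exists>c. \<forall>\<omega>\<in>space M. norm (\<xi> k \<omega>) \<le> c"
    using assms by (auto simp: simple_process_def)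
  show "\<xi> k \<in> borel_measurable M"
    using 1 by (rule measurable_F[OF simple_process_times(1)[OF assms]])
qed

abbreviation simple_ito :: "'q \<Rightarrow> nat \<Rightarrow> (nat \<Rightarrow> real) \<Rightarrow> (nat \<Rightarrow> 'a \<Rightarrow> 'b::euclidean_space) \<Rightarrow> real \<Rightarrow> 'a \<Rightarrow> 'b" where
  "simple_ito i \<equiv> simple_integral_upto (\<lambda>s \<omega>. w s \<omega> $ i)"

lemma simple_ito_inc:
  "simple_ito i m \<tau> \<xi> t \<omega> = (\<Sum>k<m. inc i (min t (\<tau> k)) (min t (\<tau> (Suc k))) \<omega> *\<^sub>R \<xi> k \<omega>)"
  by (simp add: simple_integral_upto_def inc_def)

text \<open>
  Restricting a simple process to \<open>[0,t]\<close> only moves its partition points to \<open>min t (\<tau> k)\<close>, which are the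
  times at which its stochastic integral up to \<open>t\<close> evaluates the Brownian motion.
\<close>
lemma cut_simple_value:
  assumes "simple_process M F m \<tau> \<xi>" "0 \<le> t"
  shows "cut t (simple_value m \<tau> \<xi>) z =
    (\<Sum>k<m. indicat_real {min t (\<tau> k)<..min t (\<tau> (Suc k))} (fst z) *\<^sub>R \<xi> k (snd z))"
  unfolding cut_def simple_value_def scaleR_sum_right scaleR_scaleR
proof (intro sum.cong refl)
  fix k assume "k \<in> {..<m}"
  then show "(indicat_real {0..t} (fst z) * indicat_real {\<tau> k<..\<tau> (Suc k)} (fst z)) *\<^sub>R \<xi> k (snd z)
      = indicat_real {min t (\<tau> k)<..min t (\<tau> (Suc k))} (fst z) *\<^sub>R \<xi> k (snd z)"
    using simple_process_times(1)[OF assms(1), of k] assms(2) by (auto simp: indicator_def)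
qed

lemma sqint_simple_ito_term:
  assumes "simple_process M F m \<tau> \<xi>" "k < m" "0 \<le> t"
  shows "sqint M (\<lambda>\<omega>. inc i (min t (\<tau> k)) (min t (\<tau> (Suc k))) \<omega> *\<^sub>R \<xi> k \<omega>)"
proof -
  obtain c where "\<forall>\<omega>\<in>space M. norm (\<xi> k \<omega>) \<le> c"
    using simple_process_coefficient(3)[OF assms(1,2)] by blast
  then show ?thesis
    using inc_sqint[OF simple_process_clamped_times[OF assms]]
      simple_process_coefficient(2)[OF assms(1,2)]
    by (intro sqint_scaleR_bounded) auto
qed

lemma sqint_cut_simple_term:
  assumes "simple_process M F m \<tau> \<xi>" "k < m" "0 \<le> t"
  shows "sqint (lborel \<Otimes>\<^sub>M M)
    (\<lambda>z. indicat_real {min t (\<tau> k)<..min t (\<tau> (Suc k))} (fst z) *\<^sub>R \<xi> k (snd z))"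
proof -
  let ?A = "{min t (\<tau> k)<..min t (\<tau> (Suc k))}"
  obtain c where c: "\<forall>\<omega>\<in>space M. norm (\<xi> k \<omega>) \<le> c"
    using simple_process_coefficient(3)[OF assms(1,2)] by blast
  have "emeasure lborel ?A < \<infinity>"
    using simple_process_clamped_times(2)[OF assms] by (simp only: emeasure_lborel_Ioc) simp
  then have "integrable (lborel \<Otimes>\<^sub>M M) (\<lambda>(s, \<omega>). indicator ?A s * (1::real))"
    by (intro integral_indicator_times) auto
  moreover have "(norm (indicat_real ?A s))\<^sup>2 = indicat_real ?A s * 1" for s
    by (simp add: indicator_def)
  moreover have "(\<lambda>z. indicat_real ?A (fst z)) \<in> borel_measurable (lborel \<Otimes>\<^sub>M M)"
    by (rule measurable_compose[OF measurable_fst]) simp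
  ultimately have "sqint (lborel \<Otimes>\<^sub>M M) (\<lambda>z. indicat_real ?A (fst z))"
    unfolding sqint_def case_prod_beta by (simp only: simp_thms)
  moreover have "(\<lambda>z. \<xi> k (snd z)) \<in> borel_measurable (lborel \<Otimes>\<^sub>M M)"
    using measurable_compose[OF measurable_snd simple_process_coefficient(2)[OF assms(1,2)]] .
  ultimately show ?thesis
    by (rule sqint_scaleR_bounded[where c=c]) (use c in \<open>auto simp: space_pair_measure\<close>)
qed

lemma sqint_simple_ito:
  "simple_process M F m \<tau> \<xi> \<Longrightarrow> 0 \<le> t \<Longrightarrow> sqint M (simple_ito i m \<tau> \<xi> t)"
  unfolding simple_ito_inc[abs_def] by (rule sqint_sum, rule sqint_simple_ito_term) auto

lemma sqint_cut_simple:
  assumes "simple_process M F m \<tau> \<xi>" "0 \<le> t"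
  shows "sqint (lborel \<Otimes>\<^sub>M M) (cut t (simple_value m \<tau> \<xi>))"
  unfolding cut_simple_value[OF assms, abs_def]
  by (rule sqint_sum, rule sqint_cut_simple_term[OF assms(1) _ assms(2)]) simp

text \<open>
  If clamping at \<open>t\<close> or at \<open>s\<close> has collapsed one of the two intervals, both sides vanish. Otherwise the left
  end points are the original partition points, at which the coefficients are measurable.
\<close>
lemma simple_term_isometry:
  fixes h :: "'b::euclidean_space \<Rightarrow> 'b"
  assumes h: "bounded_linear h"
    and X: "simple_process M F m \<tau> \<xi>" "k < m" "0 \<le> t"
    and Y: "simple_process M F n \<sigma> \<eta>" "l < n" "0 \<le> s"
  defines "a \<equiv> min t (\<tau> k)" and "b \<equiv> min t (\<tau> (Suc k))"
    and "c \<equiv> min s (\<sigma> l)" and "d \<equiv> min s (\<sigma> (Suc l))"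
  shows "expectation (\<lambda>\<omega>. (inc i a b \<omega> *\<^sub>R \<xi> k \<omega>) \<bullet> h (inc j c d \<omega> *\<^sub>R \<eta> l \<omega>)) =
    K $ i $ j * (LINT z|(lborel \<Otimes>\<^sub>M M). (indicat_real {a<..b} (fst z) *\<^sub>R \<xi> k (snd z)) \<bullet>
       h (indicat_real {c<..d} (fst z) *\<^sub>R \<eta> l (snd z)))"
proof -
  have ab: "0 \<le> a" "a \<le> b" and cd: "0 \<le> c" "c \<le> d"
    unfolding a_def b_def c_def d_def
    using simple_process_clamped_times[OF X] simple_process_clamped_times[OF Y] by simp_all
  have hs: "h (r *\<^sub>R v) = r *\<^sub>R h v" for r v
    using h by (simp add: bounded_linear.linear linear_scale)
  show ?thesis
  proof (cases "a = b \<or> c = d")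
    case True
    then show ?thesis by (auto simp: inc_self hs)
  next
    case False
    then have at: "a = \<tau> k" and cs: "c = \<sigma> l"
      using simple_process_times(2)[OF X(1,2)] simple_process_times(2)[OF Y(1,2)]
      by (auto simp: a_def b_def c_def d_def min_def split: if_splits)
    define \<zeta> where "\<zeta> \<omega> = \<xi> k \<omega> \<bullet> h (\<eta> l \<omega>)" for \<omega>
    have hm: "h \<in> borel_measurable borel"
      using h by (intro borel_measurable_continuous_onI linear_continuous_on)
    have x: "\<xi> k \<in> borel_measurable (F (max a c))"
      by (rule measurable_F_mono[OF _ _ simple_process_coefficient(1)[OF X(1,2)]]) (use ab cd at in auto)
    have y: "\<eta> l \<in> borel_measurable (F (max a c))"
      by (rule measurable_F_mono[OF _ _ simple_process_coefficient(1)[OF Y(1,2)]]) (use ab cd cs in auto)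
    have z: "\<zeta> \<in> borel_measurable (F (max a c))"
      unfolding \<zeta>_def using x measurable_compose[OF y hm] by (rule borel_measurable_inner)
    have zM: "\<zeta> \<in> borel_measurable M"
      using z by (rule measurable_F[rotated]) (use ab in simp)
    obtain c1 where c1: "\<forall>\<omega>\<in>space M. norm (\<xi> k \<omega>) \<le> c1"
      using simple_process_coefficient(3)[OF X(1,2)] by blast
    obtain c2 where c2: "\<forall>\<omega>\<in>space M. norm (\<eta> l \<omega>) \<le> c2"
      using simple_process_coefficient(3)[OF Y(1,2)] by blast
    obtain c3 where c3: "0 \<le> c3" "\<And>v. norm (h v) \<le> norm v * c3"
      using bounded_linear.nonneg_bounded[OF h] by blast
    have bd: "\<bar>\<zeta> \<omega>\<bar> \<le> c1 * (c2 * c3)" if "\<omega> \<in> space M" for \<omega>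
    proof -
      have "\<bar>\<zeta> \<omega>\<bar> \<le> norm (\<xi> k \<omega>) * norm (h (\<eta> l \<omega>))"
        unfolding \<zeta>_def by (rule Cauchy_Schwarz_ineq2)
      also have "\<dots> \<le> c1 * (c2 * c3)"
      proof (rule mult_mono)
        show "norm (h (\<eta> l \<omega>)) \<le> c2 * c3"
          using c3(2)[of "\<eta> l \<omega>"] c2 that mult_right_mono[OF _ c3(1)] by (meson order_trans)
        show "0 \<le> c1" using c1 that norm_ge_zero[of "\<xi> k \<omega>"] by (meson order_trans)
      qed (use c1 that in auto)
      finally show ?thesis .
    qed
    have iz: "integrable M \<zeta>"
      using bd zM by (intro integrable_const_bound[where B="c1 * (c2 * c3)"]) auto
    have "expectation (\<lambda>\<omega>. (inc i a b \<omega> *\<^sub>R \<xi> k \<omega>) \<bullet> h (inc j c d \<omega> *\<^sub>R \<eta> l \<omega>))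
        = expectation (\<lambda>\<omega>. \<zeta> \<omega> * (inc i a b \<omega> * inc j c d \<omega>))"
      by (simp add: hs \<zeta>_def mult_ac)
    also have "\<dots> = K $ i $ j * (measure lborel ({a<..b} \<inter> {c<..d}) * expectation \<zeta>)"
      by (rule covariance_of_increments(2)[OF ab cd z bd])
    also have "measure lborel ({a<..b} \<inter> {c<..d}) * expectation \<zeta>
        = (LINT (r, \<omega>)|(lborel \<Otimes>\<^sub>M M). indicator ({a<..b} \<inter> {c<..d}) r * \<zeta> \<omega>)"
    proof (rule integral_indicator_times(2)[symmetric, OF _ _ iz])
      have "emeasure lborel ({a<..b} \<inter> {c<..d}) \<le> emeasure lborel {a<..b}"
        by (rule emeasure_mono) auto
      also have "\<dots> < \<infinity>" using ab(2) by simp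
      finally show "emeasure lborel ({a<..b} \<inter> {c<..d}) < \<infinity>" .
    qed simp
    also have "\<dots> = (LINT z|(lborel \<Otimes>\<^sub>M M). (indicat_real {a<..b} (fst z) *\<^sub>R \<xi> k (snd z)) \<bullet>
       h (indicat_real {c<..d} (fst z) *\<^sub>R \<eta> l (snd z)))"
      by (intro Bochner_Integration.integral_cong) (auto simp: hs \<zeta>_def indicator_def)
    finally show ?thesis .
  qed
qed

text \<open>
  The map \<open>h\<close> inserts a matrix into the inner product, so that the quadratic form of the energy can be
  integrated without passing to coordinates.
\<close>
lemma simple_isometry:
  fixes h :: "'b::euclidean_space \<Rightarrow> 'b"
  assumes h: "bounded_linear h" and X: "simple_process M F m \<tau> \<xi>" "0 \<le> t"
    and Y: "simple_process M F n \<sigma> \<eta>" "0 \<le> s"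
  shows "expectation (\<lambda>\<omega>. simple_ito i m \<tau> \<xi> t \<omega> \<bullet> h (simple_ito j n \<sigma> \<eta> s \<omega>)) =
    K $ i $ j * (LINT z|(lborel \<Otimes>\<^sub>M M). cut t (simple_value m \<tau> \<xi>) z \<bullet> h (cut s (simple_value n \<sigma> \<eta>) z))"
proof -
  have "expectation (\<lambda>\<omega>. simple_ito i m \<tau> \<xi> t \<omega> \<bullet> h (simple_ito j n \<sigma> \<eta> s \<omega>)) =
    (\<Sum>k<m. \<Sum>l<n. expectation (\<lambda>\<omega>. (inc i (min t (\<tau> k)) (min t (\<tau> (Suc k))) \<omega> *\<^sub>R \<xi> k \<omega>) \<bullet>
       h (inc j (min s (\<sigma> l)) (min s (\<sigma> (Suc l))) \<omega> *\<^sub>R \<eta> l \<omega>)))"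
    unfolding simple_ito_inc
    by (rule integral_inner_sum[OF h]) (use sqint_simple_ito_term X Y in auto)
  also have "\<dots> = (\<Sum>k<m. \<Sum>l<n. K $ i $ j * (LINT z|(lborel \<Otimes>\<^sub>M M).
       (indicat_real {min t (\<tau> k)<..min t (\<tau> (Suc k))} (fst z) *\<^sub>R \<xi> k (snd z)) \<bullet>
       h (indicat_real {min s (\<sigma> l)<..min s (\<sigma> (Suc l))} (fst z) *\<^sub>R \<eta> l (snd z))))"
    by (intro sum.cong refl simple_term_isometry[OF h]) (use X Y in auto)
  also have "\<dots> = K $ i $ j * (LINT z|(lborel \<Otimes>\<^sub>M M).
      cut t (simple_value m \<tau> \<xi>) z \<bullet> h (cut s (simple_value n \<sigma> \<eta>) z))"
    unfolding cut_simple_value[OF X] cut_simple_value[OF Y] sum_distrib_left[symmetric]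
    by (rule arg_cong[where f="(*) _"], rule integral_inner_sum[OF h, symmetric])
       (use sqint_cut_simple_term X Y in auto)
  finally show ?thesis .
qed

section \<open>Isometry and martingale property of the Ito integral\<close>

lemma has_ito_integral_approx:
  assumes "has_ito_integral M F (\<lambda>s \<omega>. w s \<omega> $ i) f t Y" "0 \<le> t"
  obtains m \<tau> \<xi> where "\<And>j. simple_process M F (m j) (\<tau> j) (\<xi> j)"
    and "L2lim (lborel \<Otimes>\<^sub>M M) (\<lambda>j. cut t (simple_value (m j) (\<tau> j) (\<xi> j))) (cut t f)"
    and "L2lim M (\<lambda>j. simple_ito i (m j) (\<tau> j) (\<xi> j) t) Y"
proof -
  obtain m \<tau> \<xi> where f: "f \<in> L2T M F t" and Y: "Y \<in> borel_measurable M"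
    and s: "\<And>j. simple_process M F (m j) (\<tau> j) (\<xi> j)"
    and l1: "(\<lambda>j. L2T_norm_sq M t (\<lambda>s \<omega>. f s \<omega> - simple_value (m j) (\<tau> j) (\<xi> j) s \<omega>)) \<longlonglongrightarrow> 0"
    and l2: "(\<lambda>j. \<integral>\<^sup>+\<omega>. ennreal ((norm (Y \<omega> - simple_ito i (m j) (\<tau> j) (\<xi> j) t \<omega>))\<^sup>2) \<partial>M) \<longlonglongrightarrow> 0"
    using assms(1) unfolding has_ito_integral_def by blast
  have fs: "sqint (lborel \<Otimes>\<^sub>M M) (cut t f)" using f by (rule sqint_cut)
  have ss: "sqint (lborel \<Otimes>\<^sub>M M) (cut t (simple_value (m j) (\<tau> j) (\<xi> j)))" for j
    using s assms(2) by (rule sqint_cut_simple)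
  have d: "cut t (\<lambda>s \<omega>. f s \<omega> - simple_value (m j) (\<tau> j) (\<xi> j) s \<omega>)
      = (\<lambda>z. cut t f z - cut t (simple_value (m j) (\<tau> j) (\<xi> j)) z)" for j
    by (simp add: cut_def fun_eq_iff scaleR_diff_right)
  have "L2T_norm_sq M t (\<lambda>s \<omega>. f s \<omega> - simple_value (m j) (\<tau> j) (\<xi> j) s \<omega>) =
      (\<integral>\<^sup>+z. ennreal ((norm (cut t f z - cut t (simple_value (m j) (\<tau> j) (\<xi> j)) z))\<^sup>2) \<partial>(lborel \<Otimes>\<^sub>M M))" for j
    by (subst L2T_norm_sq_cut) (simp_all only: d sqint_measurable[OF sqint_diff[OF fs ss]])
  with l1 have "L2lim (lborel \<Otimes>\<^sub>M M) (\<lambda>j. cut t (simple_value (m j) (\<tau> j) (\<xi> j))) (cut t f)"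
    by (intro L2lim_nnI ss sqint_measurable[OF fs]) simp
  moreover have "L2lim M (\<lambda>j. simple_ito i (m j) (\<tau> j) (\<xi> j) t) Y"
    using s assms(2) Y l2 by (intro L2lim_nnI sqint_simple_ito)
  ultimately show thesis using that s by blast
qed

lemma has_ito_integral_sqint:
  assumes "has_ito_integral M F (\<lambda>s \<omega>. w s \<omega> $ i) f t Y" "0 \<le> t"
  shows "sqint M Y" "sqint (lborel \<Otimes>\<^sub>M M) (cut t f)"
  using has_ito_integral_approx[OF assms] by (auto simp: L2lim_def)

lemma ito_isometry:
  fixes h :: "'b::euclidean_space \<Rightarrow> 'b"
  assumes h: "bounded_linear h" and t: "0 \<le> t"
    and Y: "has_ito_integral M F (\<lambda>s \<omega>. w s \<omega> $ i) f t Y"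
    and Z: "has_ito_integral M F (\<lambda>s \<omega>. w s \<omega> $ j) g t Z"
  shows "expectation (\<lambda>\<omega>. Y \<omega> \<bullet> h (Z \<omega>)) =
    K $ i $ j * (LINT z|(lborel \<Otimes>\<^sub>M M). cut t f z \<bullet> h (cut t g z))"
proof -
  obtain m \<tau> \<xi> where X1: "\<And>j. simple_process M F (m j) (\<tau> j) (\<xi> j)"
    and X2: "L2lim (lborel \<Otimes>\<^sub>M M) (\<lambda>j. cut t (simple_value (m j) (\<tau> j) (\<xi> j))) (cut t f)"
    and X3: "L2lim M (\<lambda>j. simple_ito i (m j) (\<tau> j) (\<xi> j) t) Y"
    by (rule has_ito_integral_approx[OF Y t]) (rule that)
  obtain n \<sigma> \<eta> where Y1: "\<And>j. simple_process M F (n j) (\<sigma> j) (\<eta> j)"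
    and Y2: "L2lim (lborel \<Otimes>\<^sub>M M) (\<lambda>j. cut t (simple_value (n j) (\<sigma> j) (\<eta> j))) (cut t g)"
    and Y3: "L2lim M (\<lambda>k. simple_ito j (n k) (\<sigma> k) (\<eta> k) t) Z"
    by (rule has_ito_integral_approx[OF Z t]) (rule that)
  have "(\<lambda>k. expectation (\<lambda>\<omega>. simple_ito i (m k) (\<tau> k) (\<xi> k) t \<omega> \<bullet> h (simple_ito j (n k) (\<sigma> k) (\<eta> k) t \<omega>)))
      \<longlonglongrightarrow> expectation (\<lambda>\<omega>. Y \<omega> \<bullet> h (Z \<omega>))"
    by (rule L2lim_inner[OF X3 L2lim_linear[OF h Y3]])
  moreover have "(\<lambda>k. expectation (\<lambda>\<omega>. simple_ito i (m k) (\<tau> k) (\<xi> k) t \<omega> \<bullet> h (simple_ito j (n k) (\<sigma> k) (\<eta> k) t \<omega>)))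
      \<longlonglongrightarrow> K $ i $ j * (LINT z|(lborel \<Otimes>\<^sub>M M). cut t f z \<bullet> h (cut t g z))"
    unfolding simple_isometry[OF h X1 t Y1 t]
    by (rule tendsto_mult_left[OF L2lim_inner[OF X2 L2lim_linear[OF h Y2]]])
  ultimately show ?thesis by (rule LIMSEQ_unique)
qed

text \<open>
  Only one of the two integrands is approximated here; this mixed form is needed to compare two approximating
  sequences of the same integrand.
\<close>
lemma simple_has_ito_integral_isometry:
  assumes t: "0 \<le> t" and X: "simple_process M F m \<tau> \<xi>"
    and Z: "has_ito_integral M F (\<lambda>s \<omega>. w s \<omega> $ i) g t Z"
  shows "expectation (\<lambda>\<omega>. simple_ito i m \<tau> \<xi> t \<omega> \<bullet> Z \<omega>) =
    K $ i $ i * (LINT z|(lborel \<Otimes>\<^sub>M M). cut t (simple_value m \<tau> \<xi>) z \<bullet> cut t g z)"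
proof -
  obtain n \<sigma> \<eta> where Y1: "\<And>j. simple_process M F (n j) (\<sigma> j) (\<eta> j)"
    and Y2: "L2lim (lborel \<Otimes>\<^sub>M M) (\<lambda>j. cut t (simple_value (n j) (\<sigma> j) (\<eta> j))) (cut t g)"
    and Y3: "L2lim M (\<lambda>k. simple_ito i (n k) (\<sigma> k) (\<eta> k) t) Z"
    by (rule has_ito_integral_approx[OF Z t]) (rule that)
  have "(\<lambda>k. expectation (\<lambda>\<omega>. simple_ito i m \<tau> \<xi> t \<omega> \<bullet> simple_ito i (n k) (\<sigma> k) (\<eta> k) t \<omega>))
      \<longlonglongrightarrow> expectation (\<lambda>\<omega>. simple_ito i m \<tau> \<xi> t \<omega> \<bullet> Z \<omega>)"
    by (rule L2lim_inner[OF L2lim_const Y3]) (rule sqint_simple_ito[OF X t])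
  moreover have "(\<lambda>k. expectation (\<lambda>\<omega>. simple_ito i m \<tau> \<xi> t \<omega> \<bullet> simple_ito i (n k) (\<sigma> k) (\<eta> k) t \<omega>))
      \<longlonglongrightarrow> K $ i $ i * (LINT z|(lborel \<Otimes>\<^sub>M M). cut t (simple_value m \<tau> \<xi>) z \<bullet> cut t g z)"
    unfolding simple_isometry[OF bounded_linear_ident X t Y1 t]
    by (rule tendsto_mult_left[OF L2lim_inner[OF L2lim_const Y2]]) (rule sqint_cut_simple[OF X t])
  ultimately show ?thesis by (rule LIMSEQ_unique)
qed

lemma cut_restrict: "s \<le> t \<Longrightarrow> cut s f z = indicat_real {0..s} (fst z) *\<^sub>R cut t f z"
  by (auto simp: cut_def indicator_def)

lemma sqint_cut_restrict:
  assumes "s \<le> t" "sqint (lborel \<Otimes>\<^sub>M M) (cut t f)"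
  shows "sqint (lborel \<Otimes>\<^sub>M M) (cut s f)"
proof (rule sqintI_bound[where g="\<lambda>z. (norm (cut t f z))\<^sup>2"])
  have "(\<lambda>z. indicat_real {0..s} (fst z)) \<in> borel_measurable (lborel \<Otimes>\<^sub>M M)" by measurable
  then show "cut s f \<in> borel_measurable (lborel \<Otimes>\<^sub>M M)"
    unfolding cut_restrict[OF assms(1), abs_def]
    by (intro borel_measurable_scaleR sqint_measurable[OF assms(2)])
  show "integrable (lborel \<Otimes>\<^sub>M M) (\<lambda>z. (norm (cut t f z))\<^sup>2)" using assms(2) by (simp add: sqint_def)
qed (use assms(1) in \<open>auto simp: cut_def indicator_def\<close>)

lemma L2lim_cut_restrict:
  assumes st: "s \<le> t" and l: "L2lim (lborel \<Otimes>\<^sub>M M) (\<lambda>j. cut t (f j)) (cut t g)"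
  shows "L2lim (lborel \<Otimes>\<^sub>M M) (\<lambda>j. cut s (f j)) (cut s g)"
proof -
  have q: "sqint (lborel \<Otimes>\<^sub>M M) (cut t (f j))" "sqint (lborel \<Otimes>\<^sub>M M) (cut t g)" for j
    using l by (auto simp: L2lim_def)
  note q' = q[THEN sqint_cut_restrict[OF st]]
  have "(\<lambda>j. LINT z|(lborel \<Otimes>\<^sub>M M). (norm (cut s (f j) z - cut s g z))\<^sup>2) \<longlonglongrightarrow> 0"
  proof (rule tendsto_sandwich[where f="\<lambda>_. 0"
        and h="\<lambda>j. LINT z|(lborel \<Otimes>\<^sub>M M). (norm (cut t (f j) z - cut t g z))\<^sup>2"])
    have "(LINT z|(lborel \<Otimes>\<^sub>M M). (norm (cut s (f j) z - cut s g z))\<^sup>2)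
        \<le> (LINT z|(lborel \<Otimes>\<^sub>M M). (norm (cut t (f j) z - cut t g z))\<^sup>2)" for j
    proof (rule integral_mono)
      show "integrable (lborel \<Otimes>\<^sub>M M) (\<lambda>z. (norm (cut s (f j) z - cut s g z))\<^sup>2)"
        using sqint_diff[OF q'] by (simp add: sqint_def)
      show "integrable (lborel \<Otimes>\<^sub>M M) (\<lambda>z. (norm (cut t (f j) z - cut t g z))\<^sup>2)"
        using sqint_diff[OF q] by (simp add: sqint_def)
    qed (use st in \<open>auto simp: cut_def indicator_def\<close>)
    then show "\<forall>\<^sub>F j in sequentially. (LINT z|(lborel \<Otimes>\<^sub>M M). (norm (cut s (f j) z - cut s g z))\<^sup>2)
        \<le> (LINT z|(lborel \<Otimes>\<^sub>M M). (norm (cut t (f j) z - cut t g z))\<^sup>2)" by simp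
  qed (use l in \<open>auto simp: L2lim_def\<close>)
  then show ?thesis using q' by (simp add: L2lim_def)
qed

text \<open>
  The integrals up to \<open>s\<close> and up to \<open>t\<close> come with approximating sequences of their own. By the isometry,
  a sequence that works on \<open>[0,t]\<close> also yields the integral up to \<open>s\<close>: expanding the squared distance gives
  three terms, which converge to \<open>q\<close>, \<open>- 2 q\<close> and \<open>q\<close> for the same number \<open>q\<close>.
\<close>
lemma L2lim_simple_ito_earlier:
  assumes st: "0 \<le> s" "s \<le> t" and X: "\<And>j. simple_process M F (m j) (\<tau> j) (\<xi> j)"
    and l: "L2lim (lborel \<Otimes>\<^sub>M M) (\<lambda>j. cut t (simple_value (m j) (\<tau> j) (\<xi> j))) (cut t f)"
    and Y: "has_ito_integral M F (\<lambda>s \<omega>. w s \<omega> $ i) f s Y"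
  shows "L2lim M (\<lambda>j. simple_ito i (m j) (\<tau> j) (\<xi> j) s) Y"
proof -
  let ?I = "\<lambda>j. simple_ito i (m j) (\<tau> j) (\<xi> j) s" and ?f = "\<lambda>j. cut s (simple_value (m j) (\<tau> j) (\<xi> j))"
  let ?q = "K $ i $ i * (LINT z|(lborel \<Otimes>\<^sub>M M). cut s f z \<bullet> cut s f z)"
  have sI: "sqint M (?I j)" for j using X st(1) by (rule sqint_simple_ito)
  have sY: "sqint M Y" and sf: "sqint (lborel \<Otimes>\<^sub>M M) (cut s f)"
    using has_ito_integral_sqint[OF Y st(1)] .
  have ls: "L2lim (lborel \<Otimes>\<^sub>M M) ?f (cut s f)" by (rule L2lim_cut_restrict[OF st(2) l])
  have "expectation (\<lambda>\<omega>. (norm (?I j \<omega> - Y \<omega>))\<^sup>2) =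
     expectation (\<lambda>\<omega>. ?I j \<omega> \<bullet> ?I j \<omega>) - 2 * expectation (\<lambda>\<omega>. ?I j \<omega> \<bullet> Y \<omega>) + expectation (\<lambda>\<omega>. Y \<omega> \<bullet> Y \<omega>)" for j
  proof -
    have "(norm (?I j \<omega> - Y \<omega>))\<^sup>2 = ?I j \<omega> \<bullet> ?I j \<omega> - 2 * (?I j \<omega> \<bullet> Y \<omega>) + Y \<omega> \<bullet> Y \<omega>" for \<omega>
      by (simp add: power2_norm_eq_inner inner_diff_left inner_diff_right inner_commute)
    then show ?thesis
      using integrable_inner[OF sI sI, of j j] integrable_inner[OF sI sY, of j] integrable_inner[OF sY sY]
      by simp
  qed
  also have "\<dots> j = K $ i $ i * (LINT z|(lborel \<Otimes>\<^sub>M M). ?f j z \<bullet> ?f j z)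
      - 2 * (K $ i $ i * (LINT z|(lborel \<Otimes>\<^sub>M M). ?f j z \<bullet> cut s f z)) + ?q" for j
    using simple_isometry[OF bounded_linear_ident X st(1) X st(1), of i j i j]
      simple_has_ito_integral_isometry[OF st(1) X Y, of j] ito_isometry[OF bounded_linear_ident st(1) Y Y]
    by simp
  finally have eq: "expectation (\<lambda>\<omega>. (norm (?I j \<omega> - Y \<omega>))\<^sup>2) =
      K $ i $ i * (LINT z|(lborel \<Otimes>\<^sub>M M). ?f j z \<bullet> ?f j z)
      - 2 * (K $ i $ i * (LINT z|(lborel \<Otimes>\<^sub>M M). ?f j z \<bullet> cut s f z)) + ?q" for j .
  have "(\<lambda>j. expectation (\<lambda>\<omega>. (norm (?I j \<omega> - Y \<omega>))\<^sup>2)) \<longlonglongrightarrow> ?q - 2 * ?q + ?q"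
    unfolding eq
    by (intro tendsto_add tendsto_diff tendsto_mult tendsto_const L2lim_inner[OF ls ls]
        L2lim_inner[OF ls L2lim_const[OF sf]])
  then show ?thesis using sI sY by (simp add: L2lim_def)
qed

text \<open>
  Over \<open>(s,t]\<close> a step contributes nothing or its coefficient times one increment, which starts at the time
  \<open>max s (\<tau> k)\<close>. Both the coefficient and \<open>Z\<close> are known at that time.
\<close>
lemma simple_ito_martingale:
  assumes st: "0 \<le> s" "s \<le> t" and X: "simple_process M F m \<tau> \<xi>"
    and Z: "Z \<in> borel_measurable (F s)" "sqint M Z"
  shows "expectation (\<lambda>\<omega>. Z \<omega> \<bullet> simple_ito i m \<tau> \<xi> t \<omega>) = expectation (\<lambda>\<omega>. Z \<omega> \<bullet> simple_ito i m \<tau> \<xi> s \<omega>)"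
proof -
  have t0: "0 \<le> t" using st by simp
  let ?I = "\<lambda>t k \<omega>. inc i (min t (\<tau> k)) (min t (\<tau> (Suc k))) \<omega> *\<^sub>R \<xi> k \<omega>"
  have i: "integrable M (\<lambda>\<omega>. Z \<omega> \<bullet> ?I r k \<omega>)" if "0 \<le> r" "k < m" for r k
    by (rule integrable_inner[OF Z(2) sqint_simple_ito_term[OF X that(2,1)]])
  have coefficient: "expectation (\<lambda>\<omega>. Z \<omega> \<bullet> ?I t k \<omega>) = expectation (\<lambda>\<omega>. Z \<omega> \<bullet> ?I s k \<omega>)" if k: "k < m" for k
  proof (cases "\<tau> (Suc k) \<le> s \<or> t \<le> \<tau> k")
    case True
    then have "inc i (min t (\<tau> k)) (min t (\<tau> (Suc k))) \<omega> = inc i (min s (\<tau> k)) (min s (\<tau> (Suc k))) \<omega>" for \<omega>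
    proof
      assume "\<tau> (Suc k) \<le> s"
      then show ?thesis using st simple_process_times[OF X k] by (simp add: min_absorb2)
    next
      assume "t \<le> \<tau> k"
      then show ?thesis using st simple_process_times[OF X k] by (simp add: min_absorb1 inc_self)
    qed
    then show ?thesis by simp
  next
    case False
    define e where "e = max s (\<tau> k)"
    have e: "0 \<le> e" "e \<le> min t (\<tau> (Suc k))" "s \<le> e" "\<tau> k \<le> e"
      using False st simple_process_times[OF X k] by (auto simp: e_def)
    have "Z \<in> borel_measurable (F e)" "\<xi> k \<in> borel_measurable (F e)"
      using measurable_F_mono[OF st(1) e(3) Z(1)]
        measurable_F_mono[OF simple_process_times(1)[OF X k] e(4) simple_process_coefficient(1)[OF X k]] .
    then have m: "(\<lambda>\<omega>. Z \<omega> \<bullet> \<xi> k \<omega>) \<in> borel_measurable (F e)" by (rule borel_measurable_inner)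
    obtain c where "\<forall>\<omega>\<in>space M. norm (\<xi> k \<omega>) \<le> c"
      using simple_process_coefficient(3)[OF X k] by blast
    then have "sqint M (\<lambda>\<omega>. 1 *\<^sub>R \<xi> k \<omega>)"
      using simple_process_coefficient(2)[OF X k] by (intro sqint_scaleR_bounded[where c=c]) (auto simp: sqint_def)
    then have int: "integrable M (\<lambda>\<omega>. Z \<omega> \<bullet> \<xi> k \<omega>)" using integrable_inner[OF Z(2)] by simp
    have "expectation (\<lambda>\<omega>. Z \<omega> \<bullet> ?I t k \<omega>) - expectation (\<lambda>\<omega>. Z \<omega> \<bullet> ?I s k \<omega>)
        = expectation (\<lambda>\<omega>. Z \<omega> \<bullet> ?I t k \<omega> - Z \<omega> \<bullet> ?I s k \<omega>)"
      by (rule Bochner_Integration.integral_diff[symmetric, OF i[OF t0 k] i[OF st(1) k]])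
    also have "\<dots> = expectation (\<lambda>\<omega>. (Z \<omega> \<bullet> \<xi> k \<omega>) * inc i e (min t (\<tau> (Suc k))) \<omega>)"
      using False st simple_process_times[OF X k]
      by (intro Bochner_Integration.integral_cong) (auto simp: e_def inc_def min_def max_def algebra_simps)
    also have "\<dots> = 0" by (rule past_times_inc(2)[OF e(1,2) m int])
    finally show ?thesis by simp
  qed
  have "expectation (\<lambda>\<omega>. Z \<omega> \<bullet> simple_ito i m \<tau> \<xi> r \<omega>) = (\<Sum>k<m. expectation (\<lambda>\<omega>. Z \<omega> \<bullet> ?I r k \<omega>))"
    if "0 \<le> r" for r
    unfolding simple_ito_inc inner_sum_right
    by (rule Bochner_Integration.integral_sum) (use i that in auto)
  then show ?thesis using coefficient st(1) t0 by simp
qed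

lemma ito_martingale:
  assumes st: "0 \<le> s" "s \<le> t"
    and Y: "has_ito_integral M F (\<lambda>s \<omega>. w s \<omega> $ i) f t Y"
    and Y': "has_ito_integral M F (\<lambda>s \<omega>. w s \<omega> $ i) f s Y'"
    and Z: "Z \<in> borel_measurable (F s)" "sqint M Z"
  shows "expectation (\<lambda>\<omega>. Z \<omega> \<bullet> Y \<omega>) = expectation (\<lambda>\<omega>. Z \<omega> \<bullet> Y' \<omega>)"
proof -
  have t0: "0 \<le> t" using st by simp
  obtain m \<tau> \<xi> where X: "\<And>j. simple_process M F (m j) (\<tau> j) (\<xi> j)"
    and l: "L2lim (lborel \<Otimes>\<^sub>M M) (\<lambda>j. cut t (simple_value (m j) (\<tau> j) (\<xi> j))) (cut t f)"
    and lt: "L2lim M (\<lambda>j. simple_ito i (m j) (\<tau> j) (\<xi> j) t) Y"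
    by (rule has_ito_integral_approx[OF Y t0]) (rule that)
  have ls: "L2lim M (\<lambda>j. simple_ito i (m j) (\<tau> j) (\<xi> j) s) Y'"
    by (rule L2lim_simple_ito_earlier[OF st X l Y'])
  show ?thesis
    by (rule LIMSEQ_unique[OF L2lim_inner[OF L2lim_const[OF Z(2)] lt]])
       (unfold simple_ito_martingale[OF st X Z], rule L2lim_inner[OF L2lim_const[OF Z(2)] ls])
qed

end

section \<open>The integrated drift\<close>

lemma integrable_lborel_product:
  fixes g :: "real \<Rightarrow> 'b::euclidean_space"
  assumes h: "bounded_linear h" and g: "integrable lborel g"
  shows "integrable (lborel \<Otimes>\<^sub>M lborel) (\<lambda>(s, r). g s \<bullet> h (g r))"
proof -
  have [measurable]: "g \<in> borel_measurable borel" using g by auto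
  have [measurable]: "h \<in> borel_measurable borel"
    using h by (intro borel_measurable_continuous_onI linear_continuous_on)
  obtain c where c: "\<And>v. norm (h v) \<le> norm v * c"
    using bounded_linear.bounded[OF h] by blast
  have "integrable (lborel \<Otimes>\<^sub>M lborel) (\<lambda>(s, r). norm (g s) * (norm (g r) * c))"
  proof (rule lborel_pair.Fubini_integrable)
    show "integrable lborel (\<lambda>s. \<integral>r. norm (case (s, r) of (s, r) \<Rightarrow> norm (g s) * (norm (g r) * c)) \<partial>lborel)"
      using g by (simp add: abs_mult)
  qed (use g in auto)
  then show ?thesis
  proof (rule Bochner_Integration.integrable_bound)
    show "AE z in lborel \<Otimes>\<^sub>M lborel. norm (case z of (s, r) \<Rightarrow> g s \<bullet> h (g r))
        \<le> norm (case z of (s, r) \<Rightarrow> norm (g s) * (norm (g r) * c))"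
    proof (rule AE_I2, clarsimp)
      fix s r
      have "\<bar>g s \<bullet> h (g r)\<bar> \<le> norm (g s) * norm (h (g r))" by (rule Cauchy_Schwarz_ineq2)
      also have "\<dots> \<le> norm (g s) * (norm (g r) * c)" by (intro mult_left_mono c) simp
      also have "\<dots> \<le> \<bar>norm (g s) * (norm (g r) * c)\<bar>" by simp
      finally show "\<bar>g s \<bullet> h (g r)\<bar> \<le> \<bar>norm (g s) * (norm (g r) * c)\<bar>" .
    qed
  qed measurable
qed

text \<open>
  The left side is the integral of the symmetric kernel \<open>\<langle>g s, h (g r)\<rangle>\<close> over the plane. The two half planes
  below and above the diagonal contribute equally, and the lower one gives the integral on the right.
\<close>
lemma square_of_integral:
  fixes g :: "real \<Rightarrow> 'b::euclidean_space"
  assumes h: "bounded_linear h" and sym: "\<And>u v. u \<bullet> h v = h u \<bullet> v" and g: "integrable lborel g"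
  shows "(LINT s|lborel. g s) \<bullet> h (LINT s|lborel. g s) =
    2 * (LINT s|lborel. g s \<bullet> h (LINT r|lborel. indicat_real {..s} r *\<^sub>R g r))"
proof -
  have [measurable]: "g \<in> borel_measurable borel" using g by auto
  have [measurable]: "h \<in> borel_measurable borel"
    using h by (intro borel_measurable_continuous_onI linear_continuous_on)
  let ?H = "\<lambda>s r. g s \<bullet> h (g r)"
  note iH = integrable_lborel_product[OF h g]
  have sub: "integrable (lborel \<Otimes>\<^sub>M lborel) (\<lambda>(s, r). indicat_real S (s, r) * ?H s r)"
    if [measurable]: "S \<in> sets (borel \<Otimes>\<^sub>M borel)" for S
    by (rule Bochner_Integration.integrable_bound[OF iH]) (auto simp: indicator_def)
  let ?L = "{z \<in> space (borel \<Otimes>\<^sub>M borel). snd z \<le> (fst z :: real)}"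
  let ?U = "{z \<in> space (borel \<Otimes>\<^sub>M borel). (fst z :: real) < snd z}"
  have L: "?L \<in> sets (borel \<Otimes>\<^sub>M borel)" and U: "?U \<in> sets (borel \<Otimes>\<^sub>M borel)"
    by measurable
  have hs: "(LINT r|lborel. a \<bullet> h (k r)) = a \<bullet> h (LINT r|lborel. k r)" if "integrable lborel k" for a k
    using that integrable_bounded_linear[OF h that]
    by (subst integral_inner_right) (auto simp: integral_bounded_linear[OF h])
  have lower: "(LINT (s, r)|(lborel \<Otimes>\<^sub>M lborel). indicat_real ?L (s, r) * ?H s r)
      = (LINT s|lborel. g s \<bullet> h (LINT r|lborel. indicat_real {..s} r *\<^sub>R g r))" (is "?A = ?I")
  proof -
    have "?A = (LINT s|lborel. LINT r|lborel. g s \<bullet> h (indicat_real {..s} r *\<^sub>R g r))"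
      using lborel_pair.integral_fst'[OF sub[OF L], symmetric]
      by (simp add: linear_scale[OF bounded_linear.linear[OF h]] space_pair_measure indicator_def)
    also have "\<dots> = ?I"
      by (intro Bochner_Integration.integral_cong refl hs integrable_mult_indicator g) simp
    finally show ?thesis .
  qed
  \<comment> \<open>Swapping the variables maps the upper half plane to the lower one without its diagonal, a null set.\<close>
  have upper: "(LINT (s, r)|(lborel \<Otimes>\<^sub>M lborel). indicat_real ?U (s, r) * ?H s r) = ?I"
  proof -
    have "(LINT (s, r)|(lborel \<Otimes>\<^sub>M lborel). indicat_real ?U (s, r) * ?H s r)
      = (LINT s|lborel. LINT r|lborel. indicat_real ?U (r, s) * ?H r s)"
      using lborel_pair.integral_snd[OF sub[OF U]] by simp
    also have "\<dots> = (LINT s|lborel. LINT r|lborel. g s \<bullet> h (indicat_real {..s} r *\<^sub>R g r))"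
    proof (rule Bochner_Integration.integral_cong[OF refl])
      fix s
      show "(LINT r|lborel. indicat_real ?U (r, s) * ?H r s)
          = (LINT r|lborel. g s \<bullet> h (indicat_real {..s} r *\<^sub>R g r))"
      proof (rule Bochner_Integration.integral_cong_AE)
        show "AE r in lborel. indicat_real ?U (r, s) * ?H r s = g s \<bullet> h (indicat_real {..s} r *\<^sub>R g r)"
          using AE_lborel_singleton[of s]
        proof eventually_elim
          fix r :: real assume "r \<noteq> s"
          moreover have "?H r s = ?H s r" using sym[of "g r" "g s"] inner_commute[of "h (g r)" "g s"] by simp
          ultimately show "indicat_real ?U (r, s) * ?H r s = g s \<bullet> h (indicat_real {..s} r *\<^sub>R g r)"
            using linear_0[OF bounded_linear.linear[OF h]]
            by (cases "r \<le> s") (simp_all add: space_pair_measure)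
        qed
      qed measurable
    qed
    also have "\<dots> = ?I"
      by (intro Bochner_Integration.integral_cong refl hs integrable_mult_indicator g) simp
    finally show ?thesis .
  qed
  have "(LINT s|lborel. g s) \<bullet> h (LINT s|lborel. g s) = (LINT s|lborel. LINT r|lborel. ?H s r)"
    using hs[OF g] g by (simp add: integral_inner_left)
  also have "\<dots> = (LINT (s, r)|(lborel \<Otimes>\<^sub>M lborel). ?H s r)"
    using lborel_pair.integral_fst'[OF iH] by simp
  also have "\<dots> = (LINT z|(lborel \<Otimes>\<^sub>M lborel). (case z of (s, r) \<Rightarrow> indicat_real ?L (s, r) * ?H s r)
      + (case z of (s, r) \<Rightarrow> indicat_real ?U (s, r) * ?H s r))"
    by (intro Bochner_Integration.integral_cong) (auto simp: indicator_def space_pair_measure)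
  also have "\<dots> = ?I + ?I"
    using sub[OF L] sub[OF U] lower upper by (subst Bochner_Integration.integral_add) auto
  finally show ?thesis by simp
qed

context wiener_setting
begin

abbreviation primitive :: "(real \<Rightarrow> 'a \<Rightarrow> 'b::euclidean_space) \<Rightarrow> real \<Rightarrow> 'a \<Rightarrow> 'b" where
  "primitive b s \<omega> \<equiv> (LBINT r:{0..s}. b r \<omega>)"

lemma primitive_cut:
  assumes "s \<le> t"
  shows "primitive b s \<omega> = (LINT r|lborel. indicat_real {..s} r *\<^sub>R cut t b (r, \<omega>))"
  unfolding set_lebesgue_integral_def
  using assms by (intro Bochner_Integration.integral_cong) (auto simp: cut_def indicator_def)

text \<open>
  Stated with nonnegative integrals, the bound holds for every \<open>\<omega>\<close>, also where the path of the drift is not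
  integrable and the primitive takes the default value zero.
\<close>
lemma primitive_Cauchy_Schwarz:
  assumes b: "cut t b \<in> borel_measurable (lborel \<Otimes>\<^sub>M M)" and \<omega>: "\<omega> \<in> space M" and s: "0 \<le> s" "s \<le> t"
  shows "ennreal ((norm (primitive b s \<omega>))\<^sup>2) \<le> ennreal t * (\<integral>\<^sup>+r. ennreal ((norm (cut t b (r, \<omega>)))\<^sup>2) \<partial>lborel)"
proof -
  let ?g = "\<lambda>r. cut t b (r, \<omega>)"
  have g[measurable]: "?g \<in> borel_measurable borel"
    using measurable_compose[OF measurable_Pair2'[OF \<omega>, of lborel] b] by simp
  have eq: "primitive b s \<omega> = (LINT r|lborel. indicat_real {0..s} r *\<^sub>R ?g r)"
    unfolding set_lebesgue_integral_def
    using s by (intro Bochner_Integration.integral_cong) (auto simp: cut_def indicator_def)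
  have "ennreal (norm (primitive b s \<omega>)) \<le> (\<integral>\<^sup>+r. ennreal (indicat_real {0..s} r) * ennreal (norm (?g r)) \<partial>lborel)"
  proof (cases "integrable lborel (\<lambda>r. indicat_real {0..s} r *\<^sub>R ?g r)")
    case True
    then show ?thesis
      using integral_norm_bound_ennreal[OF True] by (simp add: eq ennreal_mult')
  next
    case False
    then show ?thesis by (simp add: eq not_integrable_integral_eq)
  qed
  then have "(ennreal (norm (primitive b s \<omega>)))\<^sup>2
      \<le> (\<integral>\<^sup>+r. ennreal (indicat_real {0..s} r) * ennreal (norm (?g r)) \<partial>lborel)\<^sup>2"
    by (rule power_mono) simp
  also have "\<dots> \<le> (\<integral>\<^sup>+r. (ennreal (indicat_real {0..s} r))\<^sup>2 \<partial>lborel) * (\<integral>\<^sup>+r. (ennreal (norm (?g r)))\<^sup>2 \<partial>lborel)"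
    by (rule Cauchy_Schwarz_nn_integral) auto
  also have "(\<integral>\<^sup>+r. (ennreal (indicat_real {0..s} r))\<^sup>2 \<partial>lborel) = (\<integral>\<^sup>+r. indicator {0..s} r \<partial>lborel)"
    by (intro nn_integral_cong) (auto simp: indicator_def)
  also have "\<dots> = ennreal s" using s by simp
  also have "ennreal s * (\<integral>\<^sup>+r. (ennreal (norm (?g r)))\<^sup>2 \<partial>lborel) \<le> ennreal t * (\<integral>\<^sup>+r. (ennreal (norm (?g r)))\<^sup>2 \<partial>lborel)"
    using s by (intro mult_right_mono ennreal_leI) auto
  finally show ?thesis by (simp add: ennreal_power)
qed

lemma sqint_primitive:
  assumes b: "sqint (lborel \<Otimes>\<^sub>M M) (cut t b)" and t: "0 \<le> t"
  shows "sqint (lborel \<Otimes>\<^sub>M M) (cut t (primitive b))" and "sqint M (primitive b t)"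
proof -
  have [measurable]: "cut t b \<in> borel_measurable (lborel \<Otimes>\<^sub>M M)" using b by (rule sqint_measurable)
  have "cut t (primitive b) z =
      (LINT r|lborel. (if 0 \<le> r \<and> r \<le> fst z \<and> fst z \<le> t then cut t b (r, snd z) else 0))" for z
  proof (cases "fst z \<in> {0..t}")
    case True
    then have "cut t (primitive b) z = primitive b (fst z) (snd z)" by (simp add: cut_def)
    also have "\<dots> = (LINT r|lborel. (if 0 \<le> r \<and> r \<le> fst z \<and> fst z \<le> t then cut t b (r, snd z) else 0))"
      unfolding set_lebesgue_integral_def using True
      by (intro Bochner_Integration.integral_cong) (auto simp: cut_def indicator_def)
    finally show ?thesis .
  next
    case False
    then have out: "(0 \<le> r \<and> r \<le> fst z \<and> fst z \<le> t) = False" for r by auto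
    have "cut t (primitive b) z = 0" using False by (auto simp: cut_def)
    then show ?thesis by (simp only: out if_False Bochner_Integration.integral_zero)
  qed
  moreover have "(\<lambda>z. LINT r|lborel. (if 0 \<le> r \<and> r \<le> fst z \<and> fst z \<le> t then cut t b (r, snd z) else 0))
      \<in> borel_measurable (lborel \<Otimes>\<^sub>M M)"
    by measurable
  ultimately have m[measurable]: "cut t (primitive b) \<in> borel_measurable (lborel \<Otimes>\<^sub>M M)"
    by (simp add: fun_eq_iff[symmetric] cong: measurable_cong)
  let ?B = "\<lambda>\<omega>. \<integral>\<^sup>+r. ennreal ((norm (cut t b (r, \<omega>)))\<^sup>2) \<partial>lborel"
  have [measurable]: "?B \<in> borel_measurable M" by measurable
  have total: "(\<integral>\<^sup>+\<omega>. ?B \<omega> \<partial>M) < \<infinity>"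
    using b by (subst Q.nn_integral_snd) (auto simp: sqint_nn)
  have "(\<integral>\<^sup>+z. ennreal ((norm (cut t (primitive b) z))\<^sup>2) \<partial>(lborel \<Otimes>\<^sub>M M))
      = (\<integral>\<^sup>+s. (\<integral>\<^sup>+\<omega>. ennreal ((norm (cut t (primitive b) (s, \<omega>)))\<^sup>2) \<partial>M) \<partial>lborel)"
    by (rule nn_integral_fst[symmetric]) measurable
  also have "\<dots> \<le> (\<integral>\<^sup>+s. (\<integral>\<^sup>+\<omega>. indicator {0..t} s * (ennreal t * ?B \<omega>) \<partial>M) \<partial>lborel)"
  proof (intro nn_integral_mono)
    fix s \<omega> assume "\<omega> \<in> space M"
    have out: "cut t (primitive b) (s, \<omega>) = (if s \<in> {0..t} then primitive b s \<omega> else 0)"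
      by (simp add: cut_def)
    show "ennreal ((norm (cut t (primitive b) (s, \<omega>)))\<^sup>2) \<le> indicator {0..t} s * (ennreal t * ?B \<omega>)"
      unfolding out using primitive_Cauchy_Schwarz[of t b \<omega> s] \<open>\<omega> \<in> space M\<close>
      by (cases "s \<in> {0..t}") auto
  qed
  also have "\<dots> = ennreal t * (ennreal t * (\<integral>\<^sup>+\<omega>. ?B \<omega> \<partial>M))"
    using t by (simp add: nn_integral_cmult nn_integral_multc)
  also have "\<dots> < \<infinity>"
    using total by (simp add: ennreal_mult_less_top)
  finally show "sqint (lborel \<Otimes>\<^sub>M M) (cut t (primitive b))"
    by (simp add: sqint_nn)
  have "(\<lambda>\<omega>. cut t (primitive b) (t, \<omega>)) \<in> borel_measurable M" by measurable
  then have mt: "primitive b t \<in> borel_measurable M"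
    using t by (simp add: cut_def)
  have "(\<integral>\<^sup>+\<omega>. ennreal ((norm (primitive b t \<omega>))\<^sup>2) \<partial>M) \<le> (\<integral>\<^sup>+\<omega>. ennreal t * ?B \<omega> \<partial>M)"
    using primitive_Cauchy_Schwarz[of t b _ t] t by (intro nn_integral_mono) auto
  also have "\<dots> < \<infinity>" using total by (simp add: nn_integral_cmult ennreal_mult_less_top)
  finally show "sqint M (primitive b t)" using mt by (simp add: sqint_nn)
qed

end

section \<open>The energy identity\<close>

lemma integrable_of_sqint_on_interval:
  fixes g :: "real \<Rightarrow> 'b::euclidean_space"
  assumes g: "sqint lborel g" and supp: "\<And>s. s \<notin> {0..t} \<Longrightarrow> g s = 0"
  shows "integrable lborel g"
proof (rule Bochner_Integration.integrable_bound)
  show "integrable lborel (\<lambda>s. indicat_real {0..t} s + (norm (g s))\<^sup>2)"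
    using g by (intro Bochner_Integration.integrable_add integrable_real_indicator) (auto simp: sqint_def emeasure_lborel_Icc_eq)
  show "g \<in> borel_measurable lborel" using g by (rule sqint_measurable)
  show "AE s in lborel. norm (g s) \<le> norm (indicat_real {0..t} s + (norm (g s))\<^sup>2)"
  proof (rule AE_I2)
    fix s
    have "2 * norm (g s) \<le> 1 + (norm (g s))\<^sup>2"
      using zero_le_power2[of "norm (g s) - 1"] unfolding power2_diff by simp
    then have "norm (g s) \<le> 1 + (norm (g s))\<^sup>2"
      using norm_ge_zero[of "g s"] by linarith
    then show "norm (g s) \<le> norm (indicat_real {0..t} s + (norm (g s))\<^sup>2)"
      using supp[of s] by (cases "s \<in> {0..t}") simp_all
  qed
qed

context wiener_setting
begin

lemma AE_section_sqint:
  fixes f :: "real \<times> 'a \<Rightarrow> 'b::euclidean_space"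
  assumes f: "sqint (lborel \<Otimes>\<^sub>M M) f"
  shows "AE \<omega> in M. sqint lborel (\<lambda>s. f (s, \<omega>))" and "AE s in lborel. sqint M (\<lambda>\<omega>. f (s, \<omega>))"
proof -
  have m: "f \<in> borel_measurable (lborel \<Otimes>\<^sub>M M)" and i: "integrable (lborel \<Otimes>\<^sub>M M) (\<lambda>z. (norm (f z))\<^sup>2)"
    using f by (auto simp: sqint_def)
  have ae: "AE \<omega> in M. integrable lborel (\<lambda>s. (norm (f (s, \<omega>)))\<^sup>2)"
    using i by (intro Q.AE_integrable_snd) (simp add: case_prod_unfold)
  have meas: "(\<lambda>s. f (s, \<omega>)) \<in> borel_measurable lborel" if "\<omega> \<in> space M" for \<omega>
    by (rule measurable_compose[OF measurable_Pair2'[OF that] m])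
  show "AE \<omega> in M. sqint lborel (\<lambda>s. f (s, \<omega>))"
    using ae AE_space
  proof eventually_elim
    fix \<omega> assume "integrable lborel (\<lambda>s. (norm (f (s, \<omega>)))\<^sup>2)" "\<omega> \<in> space M"
    then show "sqint lborel (\<lambda>s. f (s, \<omega>))"
      unfolding sqint_def using meas by blast
  qed
  have meas': "(\<lambda>\<omega>. f (s, \<omega>)) \<in> borel_measurable M" for s
    by (rule measurable_compose[OF measurable_Pair1' m]) simp
  show "AE s in lborel. sqint M (\<lambda>\<omega>. f (s, \<omega>))"
    using Q.AE_integrable_fst'[OF i] by eventually_elim (simp add: sqint_def meas')
qed

lemma AE_section_integrable:
  assumes "sqint (lborel \<Otimes>\<^sub>M M) (cut t b)"
  shows "AE \<omega> in M. integrable lborel (\<lambda>s. cut t b (s, \<omega>))"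
  using AE_section_sqint(1)[OF assms]
  by eventually_elim (rule integrable_of_sqint_on_interval[where t=t], simp_all add: cut_def)

lemma primitive_as_integral: "primitive b t \<omega> = (LINT s|lborel. cut t b (s, \<omega>))"
  by (simp add: set_lebesgue_integral_def cut_def)

lemma expectation_drift_square:
  fixes b :: "real \<Rightarrow> 'a \<Rightarrow> 'b::euclidean_space"
  assumes h: "bounded_linear h" and sym: "\<And>u v. u \<bullet> h v = h u \<bullet> v"
    and b: "sqint (lborel \<Otimes>\<^sub>M M) (cut t b)" and t: "0 \<le> t"
  shows "expectation (\<lambda>\<omega>. primitive b t \<omega> \<bullet> h (primitive b t \<omega>)) =
    2 * (LINT z|(lborel \<Otimes>\<^sub>M M). cut t b z \<bullet> h (cut t (primitive b) z))"
proof -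
  note p = sqint_primitive[OF b t]
  have iQ: "integrable (lborel \<Otimes>\<^sub>M M) (\<lambda>(s, \<omega>). cut t b (s, \<omega>) \<bullet> h (cut t (primitive b) (s, \<omega>)))"
    using integrable_inner[OF b sqint_linear[OF h p(1)]] by (simp add: case_prod_unfold)
  have ae: "AE \<omega> in M. primitive b t \<omega> \<bullet> h (primitive b t \<omega>) =
      2 * (LINT s|lborel. cut t b (s, \<omega>) \<bullet> h (cut t (primitive b) (s, \<omega>)))"
    using AE_section_integrable[OF b]
  proof eventually_elim
    fix \<omega> assume "integrable lborel (\<lambda>s. cut t b (s, \<omega>))"
    from square_of_integral[OF h sym this]
    have "primitive b t \<omega> \<bullet> h (primitive b t \<omega>) = 2 * (LINT s|lborel. cut t b (s, \<omega>) \<bullet>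
        h (LINT r|lborel. indicat_real {..s} r *\<^sub>R cut t b (r, \<omega>)))"
      by (simp only: primitive_as_integral)
    also have "(LINT s|lborel. cut t b (s, \<omega>) \<bullet> h (LINT r|lborel. indicat_real {..s} r *\<^sub>R cut t b (r, \<omega>)))
        = (LINT s|lborel. cut t b (s, \<omega>) \<bullet> h (cut t (primitive b) (s, \<omega>)))"
    proof (rule Bochner_Integration.integral_cong[OF refl])
      fix s
      show "cut t b (s, \<omega>) \<bullet> h (LINT r|lborel. indicat_real {..s} r *\<^sub>R cut t b (r, \<omega>))
          = cut t b (s, \<omega>) \<bullet> h (cut t (primitive b) (s, \<omega>))"
      proof (cases "s \<in> {0..t}")
        case True
        then have "cut t (primitive b) (s, \<omega>) = primitive b s \<omega>" by (simp add: cut_def)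
        also have "\<dots> = (LINT r|lborel. indicat_real {..s} r *\<^sub>R cut t b (r, \<omega>))"
          using True by (intro primitive_cut) simp
        finally show ?thesis by (simp only:)
      next
        case False
        then have "cut t b (s, \<omega>) = 0" by (auto simp: cut_def)
        then show ?thesis by (simp only: inner_zero_left)
      qed
    qed
    finally show "primitive b t \<omega> \<bullet> h (primitive b t \<omega>) =
      2 * (LINT s|lborel. cut t b (s, \<omega>) \<bullet> h (cut t (primitive b) (s, \<omega>)))" .
  qed
  have "expectation (\<lambda>\<omega>. primitive b t \<omega> \<bullet> h (primitive b t \<omega>)) =
      expectation (\<lambda>\<omega>. 2 * (LINT s|lborel. cut t b (s, \<omega>) \<bullet> h (cut t (primitive b) (s, \<omega>))))"
  proof (rule Bochner_Integration.integral_cong_AE[OF _ _ ae])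
    show "(\<lambda>\<omega>. primitive b t \<omega> \<bullet> h (primitive b t \<omega>)) \<in> borel_measurable M"
      using integrable_inner[OF p(2) sqint_linear[OF h p(2)]] by (rule borel_measurable_integrable)
    show "(\<lambda>\<omega>. 2 * (LINT s|lborel. cut t b (s, \<omega>) \<bullet> h (cut t (primitive b) (s, \<omega>)))) \<in> borel_measurable M"
      using Q.integrable_snd[OF iQ] by (intro borel_measurable_times borel_measurable_integrable) auto
  qed
  also have "\<dots> = 2 * expectation (\<lambda>\<omega>. LINT s|lborel. cut t b (s, \<omega>) \<bullet> h (cut t (primitive b) (s, \<omega>)))"
    by (rule integral_mult_right_zero)
  also have "expectation (\<lambda>\<omega>. LINT s|lborel. cut t b (s, \<omega>) \<bullet> h (cut t (primitive b) (s, \<omega>)))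
      = (LINT z|(lborel \<Otimes>\<^sub>M M). cut t b z \<bullet> h (cut t (primitive b) z))"
    unfolding Q.integral_snd[OF iQ] by (simp add: case_prod_unfold)
  finally show ?thesis .
qed

text \<open>
  Fubini's theorem moves the time integral out of the expectation, so that the martingale property can be
  applied at each time \<open>s\<close> separately.
\<close>
lemma expectation_drift_times:
  fixes b :: "real \<Rightarrow> 'a \<Rightarrow> 'b::euclidean_space"
  assumes b: "sqint (lborel \<Otimes>\<^sub>M M) (cut t b)" and t: "0 \<le> t" and J: "sqint M J"
  shows "integrable lborel (\<lambda>s. expectation (\<lambda>\<omega>. cut t b (s, \<omega>) \<bullet> J \<omega>))"
    and "expectation (\<lambda>\<omega>. primitive b t \<omega> \<bullet> J \<omega>) =
      (LINT s|lborel. expectation (\<lambda>\<omega>. cut t b (s, \<omega>) \<bullet> J \<omega>))"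
proof -
  have J': "J \<in> borel_measurable M" "integrable M (\<lambda>\<omega>. (norm (J \<omega>))\<^sup>2)"
    using J by (auto simp: sqint_def)
  have "sqint (lborel \<Otimes>\<^sub>M M) (\<lambda>z. indicat_real {0..t} (fst z) *\<^sub>R J (snd z))"
  proof (rule sqintI_bound)
    show "(\<lambda>z. indicat_real {0..t} (fst z) *\<^sub>R J (snd z)) \<in> borel_measurable (lborel \<Otimes>\<^sub>M M)"
      by (intro borel_measurable_scaleR measurable_compose[OF measurable_snd J'(1)]
          measurable_compose[OF measurable_fst, of _ lborel]) simp
    show "integrable (lborel \<Otimes>\<^sub>M M) (\<lambda>(s, \<omega>). indicat_real {0..t} s * (norm (J \<omega>))\<^sup>2)"
      by (rule integral_indicator_times(1)[OF _ _ J'(2)]) (use t in auto)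
  qed (auto simp: indicator_def)
  from integrable_inner[OF b this]
  have "integrable (lborel \<Otimes>\<^sub>M M) (\<lambda>z. cut t b z \<bullet> (indicat_real {0..t} (fst z) *\<^sub>R J (snd z)))" .
  moreover have "cut t b z \<bullet> (indicat_real {0..t} (fst z) *\<^sub>R J (snd z)) = cut t b z \<bullet> J (snd z)" for z
    by (simp add: cut_def indicator_def)
  ultimately have i: "integrable (lborel \<Otimes>\<^sub>M M) (\<lambda>z. cut t b z \<bullet> J (snd z))" by (simp only:)
  then have i': "integrable (lborel \<Otimes>\<^sub>M M) (\<lambda>(s, \<omega>). cut t b (s, \<omega>) \<bullet> J \<omega>)"
    by (simp add: case_prod_unfold)
  show "integrable lborel (\<lambda>s. expectation (\<lambda>\<omega>. cut t b (s, \<omega>) \<bullet> J \<omega>))"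
    using Q.integrable_fst'[OF i] by simp
  have "expectation (\<lambda>\<omega>. primitive b t \<omega> \<bullet> J \<omega>)
      = expectation (\<lambda>\<omega>. LINT s|lborel. cut t b (s, \<omega>) \<bullet> J \<omega>)"
  proof (rule Bochner_Integration.integral_cong_AE)
    show "(\<lambda>\<omega>. primitive b t \<omega> \<bullet> J \<omega>) \<in> borel_measurable M"
      by (intro borel_measurable_inner sqint_measurable sqint_primitive(2)[OF b t] J)
    show "(\<lambda>\<omega>. LINT s|lborel. cut t b (s, \<omega>) \<bullet> J \<omega>) \<in> borel_measurable M"
      using Q.integrable_snd[OF i'] by (rule borel_measurable_integrable)
    show "AE \<omega> in M. primitive b t \<omega> \<bullet> J \<omega> = (LINT s|lborel. cut t b (s, \<omega>) \<bullet> J \<omega>)"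
      using AE_section_integrable[OF b]
      by eventually_elim (simp only: primitive_as_integral integral_inner_left)
  qed
  also have "\<dots> = (LINT z|(lborel \<Otimes>\<^sub>M M). cut t b z \<bullet> J (snd z))"
    using Q.integral_snd[OF i'] by (simp add: case_prod_unfold)
  also have "\<dots> = (LINT s|lborel. expectation (\<lambda>\<omega>. cut t b (s, \<omega>) \<bullet> J \<omega>))"
    using Q.integral_fst'[OF i] by simp
  finally show "expectation (\<lambda>\<omega>. primitive b t \<omega> \<bullet> J \<omega>) =
      (LINT s|lborel. expectation (\<lambda>\<omega>. cut t b (s, \<omega>) \<bullet> J \<omega>))" .
qed

end

text \<open>
  A square integrable process with an integral representation. In the controlled equation the drift \<open>b\<close> and
  the noise coefficients \<open>f\<close> are linear in state and control; the energy identity holds for arbitrary ones.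
\<close>
locale ito_process = wiener_setting M F w K
  for M :: "'a measure" and F and w :: "real \<Rightarrow> 'a \<Rightarrow> real ^ 'q" and K +
  fixes T :: real and x b :: "real \<Rightarrow> 'a \<Rightarrow> 'b::euclidean_space" and f :: "'q \<Rightarrow> real \<Rightarrow> 'a \<Rightarrow> 'b"
  assumes x: "x \<in> L2T M F T" and b: "b \<in> L2T M F T"
    and solution: "\<And>t. t \<in> {0..T} \<Longrightarrow> \<exists>Y. (\<forall>i. has_ito_integral M F (\<lambda>s \<omega>. w s \<omega> $ i) (f i) t (Y i)) \<and>
      (AE \<omega> in M. x t \<omega> = primitive b t \<omega> + (\<Sum>i\<in>UNIV. Y i \<omega>))"
begin

text \<open>
  One version of the stochastic integrals is chosen for each time separately. The versions at different
  times are related through their integrands only, by \<open>ito_martingale\<close>.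
\<close>
definition noise :: "real \<Rightarrow> 'q \<Rightarrow> 'a \<Rightarrow> 'b" where
  "noise t = (SOME Y. (\<forall>i. has_ito_integral M F (\<lambda>s \<omega>. w s \<omega> $ i) (f i) t (Y i)) \<and>
      (AE \<omega> in M. x t \<omega> = primitive b t \<omega> + (\<Sum>i\<in>UNIV. Y i \<omega>)))"

lemma noise:
  assumes "t \<in> {0..T}"
  shows "has_ito_integral M F (\<lambda>s \<omega>. w s \<omega> $ i) (f i) t (noise t i)"
    and "AE \<omega> in M. x t \<omega> = primitive b t \<omega> + (\<Sum>i\<in>UNIV. noise t i \<omega>)"
  using someI_ex[OF solution[OF assms]] unfolding noise_def by auto

lemma sqint_data:
  assumes t: "t \<in> {0..T}"
  shows "sqint (lborel \<Otimes>\<^sub>M M) (cut t x)" "sqint (lborel \<Otimes>\<^sub>M M) (cut t b)"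
    "sqint (lborel \<Otimes>\<^sub>M M) (cut t (f i))" "sqint M (noise t i)" "sqint M (x t)"
proof -
  show "sqint (lborel \<Otimes>\<^sub>M M) (cut t x)"
    using t by (intro sqint_cut_restrict[OF _ sqint_cut[OF x]]) simp
  show cb: "sqint (lborel \<Otimes>\<^sub>M M) (cut t b)"
    using t by (intro sqint_cut_restrict[OF _ sqint_cut[OF b]]) simp
  show "sqint (lborel \<Otimes>\<^sub>M M) (cut t (f i))" and n: "sqint M (noise t i)" for i
    using has_ito_integral_sqint[OF noise(1)[OF t]] t by auto
  have "sqint M (\<lambda>\<omega>. primitive b t \<omega> + (\<Sum>i\<in>UNIV. noise t i \<omega>))"
    using t by (intro sqint_add sqint_sum n sqint_primitive(2)[OF cb]) simp
  then show "sqint M (x t)"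
  proof (rule sqint_cong_AE)
    show "x t \<in> borel_measurable M"
      using x t measurable_F[of t "x t"] by (simp add: L2T_def)
    show "AE \<omega> in M. primitive b t \<omega> + (\<Sum>i\<in>UNIV. noise t i \<omega>) = x t \<omega>"
      using noise(2)[OF t] by eventually_elim simp
  qed
qed

text \<open>
  The noise accumulated up to \<open>t\<close> may be replaced by the noise up to \<open>s\<close> in an inner product with a variable
  known at time \<open>s\<close>. The latter is expressed through \<open>x\<close> and the drift because these are jointly measurable
  in time and chance, while the chosen versions of the stochastic integrals need not be.
\<close>
lemma noise_orthogonal_to_past:
  assumes s: "0 \<le> s" "s \<le> t" "t \<le> T" and Z: "Z \<in> borel_measurable (F s)" "sqint M Z"
  shows "expectation (\<lambda>\<omega>. Z \<omega> \<bullet> (\<Sum>i\<in>UNIV. noise t i \<omega>)) = expectation (\<lambda>\<omega>. Z \<omega> \<bullet> (x s \<omega> - primitive b s \<omega>))"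
proof -
  have sT: "s \<in> {0..T}" and tT: "t \<in> {0..T}" using s by auto
  have sum: "expectation (\<lambda>\<omega>. Z \<omega> \<bullet> (\<Sum>i\<in>UNIV. noise r i \<omega>)) = (\<Sum>i\<in>UNIV. expectation (\<lambda>\<omega>. Z \<omega> \<bullet> noise r i \<omega>))"
    if "r \<in> {0..T}" for r
    unfolding inner_sum_right
    by (rule Bochner_Integration.integral_sum) (rule integrable_inner[OF Z(2) sqint_data(4)[OF that]])
  have "expectation (\<lambda>\<omega>. Z \<omega> \<bullet> (\<Sum>i\<in>UNIV. noise t i \<omega>)) = expectation (\<lambda>\<omega>. Z \<omega> \<bullet> (\<Sum>i\<in>UNIV. noise s i \<omega>))"
    unfolding sum[OF sT] sum[OF tT]
    by (intro sum.cong refl ito_martingale[OF s(1,2) noise(1)[OF tT] noise(1)[OF sT] Z])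
  also have "\<dots> = expectation (\<lambda>\<omega>. Z \<omega> \<bullet> (x s \<omega> - primitive b s \<omega>))"
  proof (rule Bochner_Integration.integral_cong_AE)
    show "(\<lambda>\<omega>. Z \<omega> \<bullet> (\<Sum>i\<in>UNIV. noise s i \<omega>)) \<in> borel_measurable M"
      using sqint_data(4)[OF sT] Z(2) by (intro borel_measurable_inner borel_measurable_sum) (auto simp: sqint_def)
    show "(\<lambda>\<omega>. Z \<omega> \<bullet> (x s \<omega> - primitive b s \<omega>)) \<in> borel_measurable M"
      by (intro borel_measurable_inner borel_measurable_diff sqint_measurable Z(2) sqint_data(5)[OF sT]
          sqint_primitive(2)[OF sqint_data(2)[OF sT] s(1)])
    show "AE \<omega> in M. Z \<omega> \<bullet> (\<Sum>i\<in>UNIV. noise s i \<omega>) = Z \<omega> \<bullet> (x s \<omega> - primitive b s \<omega>)"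
      using noise(2)[OF sT] by eventually_elim simp
  qed
  finally show ?thesis .
qed

text \<open>
  The expectation of Ito's formula for the quadratic form of \<open>h\<close>, obtained from the three terms of the square
  of drift plus noise.
\<close>
lemma energy_identity:
  assumes t: "t \<in> {0..T}" and h: "bounded_linear h" and sym: "\<And>u v. u \<bullet> h v = h u \<bullet> v"
  shows "expectation (\<lambda>\<omega>. x t \<omega> \<bullet> h (x t \<omega>)) =
    (LINT z|(lborel \<Otimes>\<^sub>M M). 2 * (cut t b z \<bullet> h (cut t x z)) +
       (\<Sum>i\<in>UNIV. \<Sum>j\<in>UNIV. K $ i $ j * (cut t (f i) z \<bullet> h (cut t (f j) z))))"
proof -
  let ?V = "primitive b t" and ?J = "\<lambda>\<omega>. \<Sum>i\<in>UNIV. noise t i \<omega>"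
  let ?Q = "lborel \<Otimes>\<^sub>M M"
  have t0: "0 \<le> t" using t by simp
  note sb = sqint_data(2)[OF t] and sx = sqint_data(1)[OF t] and sf = sqint_data(3)[OF t] and sn = sqint_data(4)[OF t]
  note sV = sqint_primitive(2)[OF sb t0] and sVQ = sqint_primitive(1)[OF sb t0]
  have sJ: "sqint M ?J" by (intro sqint_sum sn)
  have lin: "linear h" using h by (rule bounded_linear.linear)
  have iVV: "integrable M (\<lambda>\<omega>. ?V \<omega> \<bullet> h (?V \<omega>))"
    and iVJ: "integrable M (\<lambda>\<omega>. ?V \<omega> \<bullet> h (?J \<omega>))"
    and iJJ: "integrable M (\<lambda>\<omega>. ?J \<omega> \<bullet> h (?J \<omega>))"
    by (rule integrable_inner[OF sV sqint_linear[OF h sV]] integrable_inner[OF sV sqint_linear[OF h sJ]]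
        integrable_inner[OF sJ sqint_linear[OF h sJ]])+
  \<comment> \<open>The square of \<open>x(t) = V(t) + J(t)\<close>; the two mixed terms agree because \<open>h\<close> is symmetric.\<close>
  have "expectation (\<lambda>\<omega>. x t \<omega> \<bullet> h (x t \<omega>)) =
      expectation (\<lambda>\<omega>. ?V \<omega> \<bullet> h (?V \<omega>) + 2 * (?V \<omega> \<bullet> h (?J \<omega>)) + ?J \<omega> \<bullet> h (?J \<omega>))"
  proof (rule Bochner_Integration.integral_cong_AE)
    show "(\<lambda>\<omega>. x t \<omega> \<bullet> h (x t \<omega>)) \<in> borel_measurable M"
      using integrable_inner[OF sqint_data(5)[OF t] sqint_linear[OF h sqint_data(5)[OF t]]]
      by (rule borel_measurable_integrable)
    show "(\<lambda>\<omega>. ?V \<omega> \<bullet> h (?V \<omega>) + 2 * (?V \<omega> \<bullet> h (?J \<omega>)) + ?J \<omega> \<bullet> h (?J \<omega>)) \<in> borel_measurable M"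
      using iVV iVJ iJJ by (intro borel_measurable_add borel_measurable_times borel_measurable_integrable) auto
    show "AE \<omega> in M. x t \<omega> \<bullet> h (x t \<omega>) = ?V \<omega> \<bullet> h (?V \<omega>) + 2 * (?V \<omega> \<bullet> h (?J \<omega>)) + ?J \<omega> \<bullet> h (?J \<omega>)"
      using noise(2)[OF t]
    proof eventually_elim
      fix \<omega> assume eq: "x t \<omega> = ?V \<omega> + ?J \<omega>"
      have "?J \<omega> \<bullet> h (?V \<omega>) = ?V \<omega> \<bullet> h (?J \<omega>)"
        using sym[of "?J \<omega>" "?V \<omega>"] by (simp only: inner_commute)
      then show "x t \<omega> \<bullet> h (x t \<omega>) = ?V \<omega> \<bullet> h (?V \<omega>) + 2 * (?V \<omega> \<bullet> h (?J \<omega>)) + ?J \<omega> \<bullet> h (?J \<omega>)"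
        unfolding eq linear_add[OF lin] inner_add_left inner_add_right by linarith
    qed
  qed
  also have "\<dots> = expectation (\<lambda>\<omega>. ?V \<omega> \<bullet> h (?V \<omega>)) + 2 * expectation (\<lambda>\<omega>. ?V \<omega> \<bullet> h (?J \<omega>))
      + expectation (\<lambda>\<omega>. ?J \<omega> \<bullet> h (?J \<omega>))"
    using iVV iVJ iJJ by (simp del: Bochner_Integration.integral_inner_left Bochner_Integration.integral_inner_right)
  also have "expectation (\<lambda>\<omega>. ?V \<omega> \<bullet> h (?V \<omega>)) = 2 * (LINT z|?Q. cut t b z \<bullet> h (cut t (primitive b) z))"
    by (rule expectation_drift_square[OF h sym sb t0])
  also have "expectation (\<lambda>\<omega>. ?V \<omega> \<bullet> h (?J \<omega>)) = (LINT z|?Q. cut t b z \<bullet> h (cut t x z - cut t (primitive b) z))"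
  proof -
    have iW: "integrable ?Q (\<lambda>z. cut t b z \<bullet> h (cut t x z - cut t (primitive b) z))"
      by (rule integrable_inner[OF sb sqint_linear[OF h sqint_diff[OF sx sVQ]]])
    \<comment> \<open>At each time \<open>s\<close> the noise up to \<open>t\<close> is replaced by the noise up to \<open>s\<close>.\<close>
    note drift = expectation_drift_times[OF sb t0 sqint_linear[OF h sJ]]
    have "expectation (\<lambda>\<omega>. ?V \<omega> \<bullet> h (?J \<omega>)) = (LINT s|lborel. expectation (\<lambda>\<omega>. cut t b (s, \<omega>) \<bullet> h (?J \<omega>)))"
      by (rule drift(2))
    also have "\<dots> = (LINT s|lborel. expectation (\<lambda>\<omega>. cut t b (s, \<omega>) \<bullet> h (cut t x (s, \<omega>) - cut t (primitive b) (s, \<omega>))))"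
    proof (rule Bochner_Integration.integral_cong_AE)
      show "(\<lambda>s. expectation (\<lambda>\<omega>. cut t b (s, \<omega>) \<bullet> h (?J \<omega>))) \<in> borel_measurable lborel"
        using drift(1) by (rule borel_measurable_integrable)
      show "(\<lambda>s. expectation (\<lambda>\<omega>. cut t b (s, \<omega>) \<bullet> h (cut t x (s, \<omega>) - cut t (primitive b) (s, \<omega>)))) \<in> borel_measurable lborel"
        using Q.integrable_fst'[OF iW] by (rule borel_measurable_integrable)
      show "AE s in lborel. expectation (\<lambda>\<omega>. cut t b (s, \<omega>) \<bullet> h (?J \<omega>)) =
          expectation (\<lambda>\<omega>. cut t b (s, \<omega>) \<bullet> h (cut t x (s, \<omega>) - cut t (primitive b) (s, \<omega>)))"
        using AE_section_sqint(2)[OF sb]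
      proof eventually_elim
        fix s assume sq: "sqint M (\<lambda>\<omega>. cut t b (s, \<omega>))"
        show "expectation (\<lambda>\<omega>. cut t b (s, \<omega>) \<bullet> h (?J \<omega>)) =
          expectation (\<lambda>\<omega>. cut t b (s, \<omega>) \<bullet> h (cut t x (s, \<omega>) - cut t (primitive b) (s, \<omega>)))"
        proof (cases "s \<in> {0..t}")
          case True
          then have cut: "cut t g (s, \<omega>) = g s \<omega>" for g :: "real \<Rightarrow> 'a \<Rightarrow> 'b" and \<omega>
            by (simp add: cut_def)
          have m: "b s \<in> borel_measurable (F s)" using b True t by (simp add: L2T_def)
          have hm: "h \<in> borel_measurable borel"
            using h by (intro borel_measurable_continuous_onI linear_continuous_on)
          have Z: "(\<lambda>\<omega>. h (b s \<omega>)) \<in> borel_measurable (F s)" "sqint M (\<lambda>\<omega>. h (b s \<omega>))"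
            using measurable_compose[OF m hm] sqint_linear[OF h sq] by (simp_all only: cut)
          show ?thesis
            unfolding cut sym by (rule noise_orthogonal_to_past[OF _ _ _ Z]) (use True t in auto)
        next
          case False
          then have "cut t b (s, \<omega>) = 0" for \<omega> by (auto simp: cut_def)
          then show ?thesis by (simp only: inner_zero_left)
        qed
      qed
    qed
    also have "\<dots> = (LINT z|?Q. cut t b z \<bullet> h (cut t x z - cut t (primitive b) z))"
      by (rule Q.integral_fst'[OF iW])
    finally show ?thesis .
  qed
  also have "expectation (\<lambda>\<omega>. ?J \<omega> \<bullet> h (?J \<omega>)) =
      (\<Sum>i\<in>UNIV. \<Sum>j\<in>UNIV. K $ i $ j * (LINT z|?Q. cut t (f i) z \<bullet> h (cut t (f j) z)))"
    unfolding integral_inner_sum[OF h sn sn] by (simp only: ito_isometry[OF h t0 noise(1)[OF t] noise(1)[OF t]])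
  \<comment> \<open>The integrated drift cancels.\<close>
  also have "2 * (LINT z|?Q. cut t b z \<bullet> h (cut t (primitive b) z)) +
      2 * (LINT z|?Q. cut t b z \<bullet> h (cut t x z - cut t (primitive b) z)) = (LINT z|?Q. 2 * (cut t b z \<bullet> h (cut t x z)))"
    using integrable_inner[OF sb sqint_linear[OF h sVQ]] integrable_inner[OF sb sqint_linear[OF h sx]]
    by (simp add: linear_diff[OF lin] inner_diff_right)
  also have "(LINT z|?Q. 2 * (cut t b z \<bullet> h (cut t x z))) +
      (\<Sum>i\<in>UNIV. \<Sum>j\<in>UNIV. K $ i $ j * (LINT z|?Q. cut t (f i) z \<bullet> h (cut t (f j) z)))
    = (LINT z|?Q. 2 * (cut t b z \<bullet> h (cut t x z)) +
       (\<Sum>i\<in>UNIV. \<Sum>j\<in>UNIV. K $ i $ j * (cut t (f i) z \<bullet> h (cut t (f j) z))))"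
    using integrable_inner[OF sb sqint_linear[OF h sx]] integrable_inner[OF sf sqint_linear[OF h sf]]
    by (simp add: Bochner_Integration.integral_add Bochner_Integration.integral_sum
        Bochner_Integration.integrable_sum)
  finally show ?thesis .
qed

end

section \<open>The matrix inequality\<close>

lemma transpose_inner: "(transpose A *v a) \<bullet> c = a \<bullet> (A *v (c :: real ^ 'k))"
  for A :: "real ^ 'k ^ 'l"
  by (simp add: transpose_matrix_vector dot_lmul_matrix)

lemma sum_matrix_vector_mult: "(\<Sum>i\<in>I. Y i) *v a = (\<Sum>i\<in>I. Y i *v (a :: real ^ 'k))"
  for Y :: "'i \<Rightarrow> real ^ 'k ^ 'l"
  by (induction I rule: infinite_finite_induct) (simp_all add: matrix_vector_mult_add_rdistrib)

lemma pos_definite_invertible: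
  fixes P :: "real ^ 'k ^ 'k"
  assumes "pos_definite P"
  shows "P ** matrix_inv P = mat 1" "matrix_inv P ** P = mat 1"
proof -
  have "a = 0" if "P *v a = 0" for a
    using assms that unfolding pos_definite_def by (metis inner_zero_right less_irrefl)
  then have "invertible P"
    using matrix_left_invertible_ker[of P] by (simp add: invertible_left_inverse)
  then show "P ** matrix_inv P = mat 1" "matrix_inv P ** P = mat 1"
    using someI_ex[of "\<lambda>Y. P ** Y = mat 1 \<and> Y ** P = mat 1"]
    unfolding invertible_def matrix_inv_def by simp_all
qed

lemma pos_definite_inverse:
  fixes P :: "real ^ 'k ^ 'k"
  assumes P: "pos_definite P"
  shows "transpose (matrix_inv P) = matrix_inv P" and "0 \<le> a \<bullet> (matrix_inv P *v a)"
proof -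
  note inv = pos_definite_invertible[OF P]
  have "transpose (matrix_inv P) ** P = mat 1"
    using arg_cong[OF inv(1), of transpose] P by (simp add: matrix_transpose_mul pos_definite_def)
  then show "transpose (matrix_inv P) = matrix_inv P"
    by (metis inv(1) matrix_mul_assoc matrix_mul_lid matrix_mul_rid)
  have "a = P *v (matrix_inv P *v a)" by (simp add: matrix_vector_mul_assoc inv)
  then have "a \<bullet> (matrix_inv P *v a) = (matrix_inv P *v a) \<bullet> (P *v (matrix_inv P *v a))"
    by (metis inner_commute)
  also have "0 \<le> \<dots>"
    using P unfolding pos_definite_def by (metis inner_zero_left less_imp_le order_refl)
  finally show "0 \<le> a \<bullet> (matrix_inv P *v a)" .
qed

text \<open>
  The quadratic form of the inverse of \<open>P\<close> is nonnegative at \<open>a - \<langle>a, p\<rangle> p\<close>. Expand it there, using that \<open>p\<close>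
  is an eigenvector of the inverse with eigenvalue \<open>1 / l\<close>.
\<close>
lemma eigenvector_component_bound:
  fixes P :: "real ^ 'k ^ 'k"
  assumes P: "pos_definite P" and e: "P *v p = l *\<^sub>R p" and l: "0 < l" and p: "p \<bullet> p = 1"
  shows "(a \<bullet> p)\<^sup>2 \<le> l * (a \<bullet> (matrix_inv P *v a))"
proof -
  let ?X = "matrix_inv P"
  note inv = pos_definite_inverse[OF P]
  have "l *\<^sub>R (?X *v p) = ?X *v (P *v p)" by (simp add: e matrix_vector_mult_scaleR)
  also have "\<dots> = p" by (simp add: matrix_vector_mul_assoc pos_definite_invertible[OF P])
  finally have Xp: "?X *v p = (1 / l) *\<^sub>R p" using l by (metis divide_inverse mult_1 scaleR_scaleR
    right_inverse scaleR_one less_irrefl mult.commute)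
  have sym: "p \<bullet> (?X *v a) = (a \<bullet> p) / l"
    using transpose_inner[of ?X p a] inv(1) Xp by (simp add: inner_commute)
  have "0 \<le> (a - (a \<bullet> p) *\<^sub>R p) \<bullet> (?X *v (a - (a \<bullet> p) *\<^sub>R p))" by (rule inv(2))
  also have "\<dots> = a \<bullet> (?X *v a) - (a \<bullet> p)\<^sup>2 / l"
    using p by (simp add: matrix_vector_mult_diff_distrib matrix_vector_mult_scaleR Xp sym
        inner_diff_left inner_diff_right power2_eq_square)
  finally show ?thesis using l by (simp add: field_simps)
qed

text \<open>
  The control \<open>y = U\<^sup>-\<^sup>1 S\<^sup>T a\<close> maximises \<open>2 \<langle>a, S v\<rangle> - \<langle>v, U v\<rangle>\<close> over all \<open>v\<close>. Positivity of \<open>\<langle>v - y, U (v - y)\<rangle>\<close>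
  bounds this expression by \<open>\<langle>a, S U\<^sup>-\<^sup>1 S\<^sup>T a\<rangle>\<close>, and the Riccati inequality bounds that in turn
  by \<open>- \<langle>a, L a\<rangle>\<close>.
\<close>
lemma energy_rate_bound:
  fixes A :: "real ^ 'n ^ 'n" and B :: "real ^ 'm ^ 'n"
    and N :: "'q::finite \<Rightarrow> real ^ 'n ^ 'n" and Mc :: "'q \<Rightarrow> real ^ 'm ^ 'n" and X :: "real ^ 'n ^ 'n"
  assumes X: "transpose X = X" and K: "\<And>i j. K $ i $ j = K $ j $ i"
    and U: "pos_definite (op_U \<gamma> Mc K X)"
    and R: "loewner_le (op_L A N K X +
       op_S B N Mc K X ** matrix_inv (op_U \<gamma> Mc K X) ** transpose (op_S B N Mc K X)) 0"
  shows "2 * ((A *v a + B *v v) \<bullet> (X *v a)) +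
      (\<Sum>i\<in>UNIV. \<Sum>j\<in>UNIV. K $ i $ j * ((N i *v a + Mc i *v v) \<bullet> (X *v (N j *v a + Mc j *v v))))
    \<le> \<gamma> * (v \<bullet> v)"
proof -
  let ?L = "op_L A N K X" and ?S = "op_S B N Mc K X" and ?U = "op_U \<gamma> Mc K X"
  let ?D = "\<lambda>(F :: 'q \<Rightarrow> real ^ 'n) G. \<Sum>i\<in>UNIV. \<Sum>j\<in>UNIV. K $ i $ j * (F i \<bullet> (X *v G j))"
  let ?Na = "\<lambda>i. N i *v a" and ?Mv = "\<lambda>i. Mc i *v v"
  have Xs: "c \<bullet> (X *v d) = (X *v c) \<bullet> d" for c d
    using transpose_inner[of X c d] X by simp
  have form: "c \<bullet> ((transpose G ** X ** H) *v d) = (G *v c) \<bullet> (X *v (H *v d))"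
    for G :: "real ^ 'k ^ 'n" and H :: "real ^ 'l ^ 'n" and c d
    using transpose_inner[of "transpose G" c]
    by (simp add: matrix_vector_mul_assoc[symmetric] transpose_transpose)
  have "a \<bullet> ((transpose A ** X) *v a) = (A *v a) \<bullet> (X *v a)"
    using transpose_inner[of "transpose A" a "X *v a"]
    by (simp only: matrix_vector_mul_assoc[symmetric] transpose_transpose)
  moreover have "a \<bullet> ((X ** A) *v a) = (A *v a) \<bullet> (X *v a)"
    using Xs[of a "A *v a"] by (simp only: matrix_vector_mul_assoc[symmetric] inner_commute)
  ultimately have L: "a \<bullet> (?L *v a) = 2 * ((A *v a) \<bullet> (X *v a)) + ?D ?Na ?Na"
    unfolding op_L_def
    by (simp only: matrix_vector_mult_add_rdistrib sum_matrix_vector_mult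
        scaleR_matrix_vector_assoc[symmetric] inner_add_right inner_sum_right form inner_scaleR_right)
  have S: "a \<bullet> (?S *v v) = (B *v v) \<bullet> (X *v a) + ?D ?Na ?Mv"
  proof -
    have "a \<bullet> ((X ** B) *v v) = (B *v v) \<bullet> (X *v a)"
      using Xs[of a "B *v v"] by (simp only: matrix_vector_mul_assoc[symmetric] inner_commute)
    then show ?thesis
      unfolding op_S_def
      by (simp only: matrix_vector_mult_add_rdistrib sum_matrix_vector_mult
          scaleR_matrix_vector_assoc[symmetric] inner_add_right inner_sum_right form inner_scaleR_right)
  qed
  have Uv: "v \<bullet> (?U *v v) = \<gamma> * (v \<bullet> v) - ?D ?Mv ?Mv"
    by (simp add: op_U_def matrix_vector_mult_diff_rdistrib sum_matrix_vector_mult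
        scaleR_matrix_vector_assoc[symmetric] inner_diff_right inner_sum_right form)
  have cross: "?D ?Mv ?Na = ?D ?Na ?Mv"
  proof -
    have "?D ?Mv ?Na = (\<Sum>j\<in>UNIV. \<Sum>i\<in>UNIV. K $ i $ j * (?Mv i \<bullet> (X *v ?Na j)))"
      by (rule sum.swap)
    also have "\<dots> = ?D ?Na ?Mv"
    proof (intro sum.cong refl)
      fix i j
      show "K $ j $ i * (?Mv j \<bullet> (X *v ?Na i)) = K $ i $ j * (?Na i \<bullet> (X *v ?Mv j))"
        using K[of i j] Xs[of "?Mv j" "?Na i"] by (simp add: inner_commute)
    qed
    finally show ?thesis .
  qed
  have expand: "(\<Sum>i\<in>UNIV. \<Sum>j\<in>UNIV. K $ i $ j * ((?Na i + ?Mv i) \<bullet> (X *v (?Na j + ?Mv j))))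
      = ?D ?Na ?Na + ?D ?Na ?Mv + ?D ?Mv ?Na + ?D ?Mv ?Mv"
    by (simp add: matrix_vector_right_distrib inner_add_left inner_add_right distrib_left sum.distrib)
  define y where "y = matrix_inv ?U *v (transpose ?S *v a)"
  have Uy: "?U *v y = transpose ?S *v a"
    by (simp add: y_def matrix_vector_mul_assoc pos_definite_invertible(1)[OF U])
  have US: "transpose ?U = ?U" using U by (simp add: pos_definite_def)
  have "0 \<le> (v - y) \<bullet> (?U *v (v - y))"
    using U unfolding pos_definite_def by (metis inner_zero_left less_imp_le order_refl)
  also have "\<dots> = v \<bullet> (?U *v v) - 2 * (a \<bullet> (?S *v v)) + a \<bullet> (?S *v y)"
    using transpose_inner[of ?U y v] US Uy transpose_inner[of ?S a v] transpose_inner[of ?S a y]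
    by (simp add: matrix_vector_mult_diff_distrib inner_diff_left inner_diff_right inner_commute)
  finally have square: "0 \<le> v \<bullet> (?U *v v) - 2 * (a \<bullet> (?S *v v)) + a \<bullet> (?S *v y)" .
  have "0 \<le> a \<bullet> ((0 - (?L + ?S ** matrix_inv ?U ** transpose ?S)) *v a)"
    using R unfolding loewner_le_def pos_semidefinite_def by blast
  then have "a \<bullet> (?L *v a) + a \<bullet> (?S *v y) \<le> 0"
    unfolding y_def
    by (simp only: matrix_vector_mult_diff_rdistrib matrix_vector_mult_add_rdistrib matrix_vector_mult_0
        matrix_vector_mul_assoc[symmetric] inner_add_right inner_diff_right inner_zero_right)
  then show ?thesis
    using L S Uv cross square unfolding expand by (simp add: inner_add_left)
qed

section \<open>The controlled equation\<close>

context wiener_setting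
begin

lemma cut_matrix_combination:
  fixes A :: "real ^ 'n ^ 'k" and B :: "real ^ 'm ^ 'k"
  shows
  "cut t (\<lambda>s \<omega>. A *v x s \<omega> + B *v u s \<omega>) z = A *v cut t x z + B *v cut t u z"
  by (simp add: cut_def matrix_vector_mult_scaleR scaleR_add_right)

lemma L2T_matrix_combination:
  fixes A :: "real ^ 'n ^ 'k" and B :: "real ^ 'm ^ 'k"
  assumes x: "x \<in> L2T M F T" and u: "u \<in> L2T M F T"
  shows "(\<lambda>s \<omega>. A *v x s \<omega> + B *v u s \<omega>) \<in> L2T M F T"
proof -
  have A[measurable]: "(\<lambda>v. A *v v) \<in> borel_measurable borel" and B[measurable]: "(\<lambda>v. B *v v) \<in> borel_measurable borel"
    by (intro borel_measurable_continuous_onI linear_continuous_on matrix_vector_mul_bounded_linear)+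
  let ?b = "\<lambda>s \<omega>. A *v x s \<omega> + B *v u s \<omega>"
  have sq: "sqint (lborel \<Otimes>\<^sub>M M) (cut T ?b)"
    unfolding cut_matrix_combination[abs_def]
    by (intro sqint_add sqint_linear[OF matrix_vector_mul_bounded_linear] sqint_cut x u)
  have "L2T_norm_sq M T ?b < \<infinity>"
    using sq sqint_measurable[OF sq] by (simp add: L2T_norm_sq_cut sqint_nn)
  moreover have "?b t \<in> borel_measurable (F t)" if "t \<in> {0..T}" for t
    using x u that
    by (intro borel_measurable_add measurable_compose[OF _ A] measurable_compose[OF _ B]) (auto simp: L2T_def)
  moreover have "(\<lambda>(t, \<omega>). ?b t \<omega>) \<in> borel_measurable (restrict_space borel {0..T} \<Otimes>\<^sub>M M)"
  proof -
    have "(\<lambda>(t, \<omega>). x t \<omega>) \<in> borel_measurable (restrict_space borel {0..T} \<Otimes>\<^sub>M M)"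
      "(\<lambda>(t, \<omega>). u t \<omega>) \<in> borel_measurable (restrict_space borel {0..T} \<Otimes>\<^sub>M M)"
      using x u unfolding L2T_def by blast+
    then show ?thesis
      unfolding case_prod_unfold
      by (intro borel_measurable_add measurable_compose[OF _ A] measurable_compose[OF _ B])
  qed
  ultimately show ?thesis by (simp add: L2T_def)
qed

end

theorem theorem3p3:
  fixes M :: "'a measure" and F :: "real \<Rightarrow> 'a measure"
    and w :: "real \<Rightarrow> 'a \<Rightarrow> real ^ 'q" and K :: "real ^ 'q ^ 'q"
    and A :: "real ^ 'n ^ 'n" and B :: "real ^ 'm ^ 'n"
    and N :: "'q \<Rightarrow> real ^ 'n ^ 'n" and Mc :: "'q \<Rightarrow> real ^ 'm ^ 'n"
    and u :: "real \<Rightarrow> 'a \<Rightarrow> real ^ 'm" and x :: "real \<Rightarrow> 'a \<Rightarrow> real ^ 'n"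
    and T \<gamma> :: real and P :: "real ^ 'n ^ 'n"
    and p :: "'n \<Rightarrow> real ^ 'n" and lam :: "'n \<Rightarrow> real"
  assumes "prob_space M"
    and "usual_filtration M F"
    and "wiener_process M F K w"
    and "0 < T"
    and "mean_square_asymptotically_stable M F w A B N Mc"
    and "u \<in> L2T M F T"
    and "sde_solution M F w A B N Mc u 0 T x"
    and "0 < \<gamma>"
    and "pos_definite P"
    and "pos_definite (op_U \<gamma> Mc K (matrix_inv P))"
    and "loewner_le
           (op_L A N K (matrix_inv P) +
              op_S B N Mc K (matrix_inv P) ** matrix_inv (op_U \<gamma> Mc K (matrix_inv P))
                ** transpose (op_S B N Mc K (matrix_inv P)))
           0"
    and "orthonormal_basis p"
    and "\<And>k. P *v p k = lam k *\<^sub>R p k"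
    and "\<And>k. 0 < lam k"
  shows "\<forall>k. (SUP t\<in>{0..T}. \<integral>\<^sup>+\<omega>. ennreal ((x t \<omega> \<bullet> p k)\<^sup>2) \<partial>M)
               \<le> ennreal (lam k * \<gamma>) * L2T_norm_sq M T u"
proof (intro allI SUP_least)
  fix k t assume t: "t \<in> {0..T}"
  interpret wiener_setting M F w K
    using assms(1-3) by (simp add: wiener_setting_def wiener_setting_axioms_def)
  let ?X = "matrix_inv P" and ?Q = "lborel \<Otimes>\<^sub>M M"
  let ?b = "\<lambda>s \<omega>. A *v x s \<omega> + B *v u s \<omega>" and ?f = "\<lambda>i s \<omega>. N i *v x s \<omega> + Mc i *v u s \<omega>"
  have xL: "x \<in> L2T M F T" using assms(7) by (simp add: sde_solution_def)
  interpret ito_process M F w K T x ?b ?f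
  proof (unfold_locales)
    show "x \<in> L2T M F T" by (fact xL)
    show "?b \<in> L2T M F T" by (rule L2T_matrix_combination[OF xL assms(6)])
    show "\<exists>Y. (\<forall>i. has_ito_integral M F (\<lambda>s \<omega>. w s \<omega> $ i) (?f i) r (Y i)) \<and>
      (AE \<omega> in M. x r \<omega> = primitive ?b r \<omega> + (\<Sum>i\<in>UNIV. Y i \<omega>))" if "r \<in> {0..T}" for r
      using assms(7) that by (simp add: sde_solution_def)
  qed
  have X: "transpose ?X = ?X" and Xpos: "\<And>a. 0 \<le> a \<bullet> (?X *v a)"
    using pos_definite_inverse[OF assms(9)] by auto
  have lin: "bounded_linear (\<lambda>v. ?X *v v)" by (rule matrix_vector_mul_bounded_linear)
  have Xs: "c \<bullet> (?X *v d) = (?X *v c) \<bullet> d" for c d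
    using transpose_inner[of ?X c d] X by simp
  have su: "sqint ?Q (cut T u)" using assms(6) by (rule sqint_cut)
  have sut: "sqint ?Q (cut t u)" by (rule sqint_cut_restrict[OF _ su]) (use t in simp)
  note sx = sqint_data(5)[OF t]
  have ix: "integrable M (\<lambda>\<omega>. x t \<omega> \<bullet> (?X *v x t \<omega>))"
    by (rule integrable_inner[OF sx sqint_linear[OF lin sx]])
  let ?rate = "\<lambda>z. 2 * (cut t ?b z \<bullet> (?X *v cut t x z)) +
       (\<Sum>i\<in>UNIV. \<Sum>j\<in>UNIV. K $ i $ j * (cut t (?f i) z \<bullet> (?X *v cut t (?f j) z)))"
  have irate: "integrable ?Q ?rate"
    using integrable_inner[OF sqint_data(2)[OF t] sqint_linear[OF lin sqint_data(1)[OF t]]]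
      integrable_inner[OF sqint_data(3)[OF t] sqint_linear[OF lin sqint_data(3)[OF t]]]
    by (intro Bochner_Integration.integrable_add Bochner_Integration.integrable_sum
        Bochner_Integration.integrable_mult_right)
  have "expectation (\<lambda>\<omega>. x t \<omega> \<bullet> (?X *v x t \<omega>)) = (LINT z|?Q. ?rate z)"
    by (rule energy_identity[OF t lin Xs])
  also have "\<dots> \<le> (LINT z|?Q. \<gamma> * (norm (cut T u z))\<^sup>2)"
  proof (rule integral_mono[OF irate])
    show "integrable ?Q (\<lambda>z. \<gamma> * (norm (cut T u z))\<^sup>2)" using su by (simp add: sqint_def)
    fix z
    have "?rate z \<le> \<gamma> * (cut t u z \<bullet> cut t u z)"
      unfolding cut_matrix_combination
      by (rule energy_rate_bound[OF X covariance_symmetric assms(10,11)])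
    also have "\<dots> \<le> \<gamma> * (norm (cut T u z))\<^sup>2"
      using assms(8) t by (intro mult_left_mono) (auto simp: cut_def indicator_def power2_norm_eq_inner)
    finally show "?rate z \<le> \<gamma> * (norm (cut T u z))\<^sup>2" .
  qed
  also have "\<dots> = \<gamma> * (LINT z|?Q. (norm (cut T u z))\<^sup>2)" by simp
  finally have energy: "expectation (\<lambda>\<omega>. x t \<omega> \<bullet> (?X *v x t \<omega>)) \<le> \<gamma> * (LINT z|?Q. (norm (cut T u z))\<^sup>2)" .
  have pk: "p k \<bullet> p k = 1" using assms(12) by (simp add: orthonormal_basis_def)
  have "(\<integral>\<^sup>+\<omega>. ennreal ((x t \<omega> \<bullet> p k)\<^sup>2) \<partial>M) \<le> (\<integral>\<^sup>+\<omega>. ennreal (lam k * (x t \<omega> \<bullet> (?X *v x t \<omega>))) \<partial>M)"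
    by (intro nn_integral_mono ennreal_leI eigenvector_component_bound[OF assms(9,13,14) pk])
  also have "\<dots> = ennreal (lam k * expectation (\<lambda>\<omega>. x t \<omega> \<bullet> (?X *v x t \<omega>)))"
    using ix Xpos assms(14)[of k] by (subst nn_integral_eq_integral) (auto intro!: mult_nonneg_nonneg)
  also have "\<dots> \<le> ennreal (lam k * (\<gamma> * (LINT z|?Q. (norm (cut T u z))\<^sup>2)))"
    using energy assms(14)[of k] by (intro ennreal_leI mult_left_mono) auto
  also have "\<dots> = ennreal (lam k * \<gamma>) * ennreal (LINT z|?Q. (norm (cut T u z))\<^sup>2)"
    using assms(8) assms(14)[of k] by (subst ennreal_mult[symmetric]) (auto simp: mult.assoc)
  also have "ennreal (LINT z|?Q. (norm (cut T u z))\<^sup>2) = L2T_norm_sq M T u"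
    using su by (simp add: L2T_norm_sq_cut[OF sqint_measurable[OF su]] nn_integral_eq_integral sqint_def)
  finally show "(\<integral>\<^sup>+\<omega>. ennreal ((x t \<omega> \<bullet> p k)\<^sup>2) \<partial>M) \<le> ennreal (lam k * \<gamma>) * L2T_norm_sq M T u" .
qed

end
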